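(* Let $\mathbb{A}$ be a PCA with elementary sub-PCA $\mathbb{A}'$. The full existential completion of the Medvedev doctrine $\mathfrak{M}\colon\mathsf{Set}^{\mathrm{op}}\to\mathsf{Pos}$ is isomorphic to the doctrine $\mathfrak{D}\colon\mathsf{Set}^{\mathrm{op}}\to\mathsf{Pos}$: $$\mathfrak{M}^{\exists_{\mathsf f}}\cong\mathfrak{D}.$$
   Context: A partial combinatory algebra (PCA) is a set $\mathbb{A}$ with a partial binary operation $\cdot$ (application, associating to the left; $ab\downarrow$ means that $ab$ is defined; $x\simeq y$ means that $x$ is defined whenever $y$ is, in which case they are equal) for which there exist $k,s\in\mathbb{A}$ such that for all $a,b,c\in\mathbb{A}$: $ka\downarrow$, $kab\simeq a$, $sa\downarrow$, $sab\downarrow$, $sabc\simeq ac(bc)$. An elementary sub-PCA is a subset $\mathbb{A}'\subseteq\mathbb{A}$ closed under (defined) application that contains elements $k,s$ such that $ka\downarrow$, $kab\simeq a$, $sa\downarrow$, $sab\downarrow$ and $sabc\simeq ac(bc)$ for all $a,b,c\in\mathbb{A}$. Assertions such as $a\cdot b\in S$ include that $a\cdot b$ is defined. A doctrine is a functor $P\colon\mathcal{C}^{\mathrm{op}}\to\mathsf{Pos}$ with $\mathcal{C}$ having finite products; an isomorphism of doctrines on the same base is a natural family of poset isomorphisms. Full existential completion ($\mathcal{C}$ with pullbacks): $P^{\exists_{\mathsf f}}(A)$ is the poset reflection of the preorder of pairs $(f,\alpha)$ with $f\colon B\to A$ in $\mathcal{C}$ and $\alpha\in P(B)$, where $(f\colon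 B\to A,\alpha)\le(g\colon C\to A,\beta)$ iff there is $h\colon B\to C$ with $gh=f$ and $\alpha\le P_h(\beta)$. For $u\colon A'\to A$, the action sends $(g\colon C\to A,\beta)$ to $(u^*g\colon D\to A',P_{g^*u}(\beta))$, where $D=A'\times_A C$ with projections $u^*g\colon D\to A'$ and $g^*u\colon D\to C$. Medvedev doctrine: $\mathfrak{M}(X)$ is the poset reflection of the set of functions $X\to\wp(\mathbb{A})$ preordered by $\varphi\le_{\mathrm M}\psi$ iff there is $\overline a\in\mathbb{A}'$ such that for all $x\in X$ and $b\in\psi(x)$, $\overline a\cdot b\in\varphi(x)$; it acts by precomposition. Doctrine $\mathfrak{D}$: $\mathfrak{D}(X)$ is the poset reflection of the preorder whose objects are functions $F\colon R\to\wp(\mathbb{A})$ with $R\subseteq X\times\wp(\mathbb{A})$ (write $x\Vdash_R A$ for $(x,A)\in R$), where for $F\colon R\to\wp(\mathbb{A})$ and $G\colon S\to\wp(\mathbb{A})$, $F\le_D G$ iff there are a function $\varphi\colon R\to\wp(\mathbb{A})$ and $\overline h\in\mathbb{A}'$ such that for every $x\Vdash_R A$: $x\Vdash_S\varphi(x,A)$ and $(\forall q\in G(x,\varphi(x,A)))(\overline h\cdot q\in F(x,A))$. It acts by precomposition: $u\colon X'\to X$ sends $F\colon R\to\wp(\mathbb{A})$ to $(x',A)\mapsto F(u(x'),A)$ on $\{(x',A):(u(x'),A)\in R\}$. *)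

theory Defs
  imports Main "HOL-Library.FuncSet"
begin

section \<open>Categories with finite products and pullbacks\<close>

record ('o, 'm) cat =
  Obj :: "'o set"
  Arr :: "'m set"
  Dom :: "'m \<Rightarrow> 'o"
  Cod :: "'m \<Rightarrow> 'o"
  Ide :: "'o \<Rightarrow> 'm"
  Cmp :: "'m \<Rightarrow> 'm \<Rightarrow> 'm"  \<comment> \<open>\<open>Cmp C g f\<close> is "g after f"\<close>

definition hom :: "('o, 'm) cat \<Rightarrow> 'o \<Rightarrow> 'o \<Rightarrow> 'm set" where
  "hom C X Y = {f \<in> Arr C. Dom C f = X \<and> Cod C f = Y}"

locale category =
  fixes C :: "('o, 'm) cat"
  assumes Dom_Obj: "f \<in> Arr C \<Longrightarrow> Dom C f \<in> Obj C"
    and Cod_Obj: "f \<in> Arr C \<Longrightarrow> Cod C f \<in> Obj C"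
    and Ide_hom: "X \<in> Obj C \<Longrightarrow> Ide C X \<in> hom C X X"
    and Cmp_hom: "f \<in> hom C X Y \<Longrightarrow> g \<in> hom C Y Z \<Longrightarrow> Cmp C g f \<in> hom C X Z"
    and Cmp_Ide_right: "f \<in> hom C X Y \<Longrightarrow> Cmp C f (Ide C X) = f"
    and Cmp_Ide_left: "f \<in> hom C X Y \<Longrightarrow> Cmp C (Ide C Y) f = f"
    and Cmp_assoc: "f \<in> hom C W X \<Longrightarrow> g \<in> hom C X Y \<Longrightarrow> h \<in> hom C Y Z \<Longrightarrow>
      Cmp C h (Cmp C g f) = Cmp C (Cmp C h g) f"

definition is_terminal :: "('o, 'm) cat \<Rightarrow> 'o \<Rightarrow> bool" where
  "is_terminal C T \<longleftrightarrow> T \<in> Obj C \<and> (\<forall>X\<in>Obj C. \<exists>!f. f \<in> hom C X T)"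

definition is_product :: "('o, 'm) cat \<Rightarrow> 'o \<Rightarrow> 'o \<Rightarrow> 'o \<Rightarrow> 'm \<Rightarrow> 'm \<Rightarrow> bool" where
  "is_product C X Y Z p q \<longleftrightarrow> Z \<in> Obj C \<and> p \<in> hom C Z X \<and> q \<in> hom C Z Y \<and>
     (\<forall>W\<in>Obj C. \<forall>f\<in>hom C W X. \<forall>g\<in>hom C W Y.
        \<exists>!h. h \<in> hom C W Z \<and> Cmp C p h = f \<and> Cmp C q h = g)"

definition has_finite_products :: "('o, 'm) cat \<Rightarrow> bool" where
  "has_finite_products C \<longleftrightarrow> (\<exists>T. is_terminal C T) \<and>
     (\<forall>X\<in>Obj C. \<forall>Y\<in>Obj C. \<exists>Z p q. is_product C X Y Z p q)"

text \<open>\<open>is_pullback C u g p q\<close>: the square \<open>u \<circ> p = g \<circ> q\<close> is a pullback of the cospan \<open>(u, g)\<close>,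
  so that \<open>p\<close> is \<open>u\<^sup>*g\<close> and \<open>q\<close> is \<open>g\<^sup>*u\<close>.\<close>

definition is_pullback :: "('o, 'm) cat \<Rightarrow> 'm \<Rightarrow> 'm \<Rightarrow> 'm \<Rightarrow> 'm \<Rightarrow> bool" where
  "is_pullback C u g p q \<longleftrightarrow>
     p \<in> hom C (Dom C p) (Dom C u) \<and> q \<in> hom C (Dom C p) (Dom C g) \<and> Cmp C u p = Cmp C g q \<and>
     (\<forall>W\<in>Obj C. \<forall>f\<in>hom C W (Dom C u). \<forall>f'\<in>hom C W (Dom C g). Cmp C u f = Cmp C g f' \<longrightarrow>
        (\<exists>!h. h \<in> hom C W (Dom C p) \<and> Cmp C p h = f \<and> Cmp C q h = f'))"

definition has_pullbacks :: "('o, 'm) cat \<Rightarrow> bool" where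
  "has_pullbacks C \<longleftrightarrow>
     (\<forall>u\<in>Arr C. \<forall>g\<in>Arr C. Cod C u = Cod C g \<longrightarrow> (\<exists>p q. is_pullback C u g p q))"


section \<open>Doctrines\<close>

record ('o, 'm, 'p) indexed_poset =
  Fib :: "'o \<Rightarrow> 'p set"
  Le :: "'o \<Rightarrow> 'p rel"
  Reind :: "'m \<Rightarrow> 'p \<Rightarrow> 'p"

locale doctrine = category C for C :: "('o, 'm) cat" +
  fixes P :: "('o, 'm, 'p) indexed_poset"
  assumes finite_products: "has_finite_products C"
    and Fib_poset: "X \<in> Obj C \<Longrightarrow> partial_order_on (Fib P X) (Le P X)"
    and Reind_Fib: "u \<in> hom C X Y \<Longrightarrow> \<alpha> \<in> Fib P Y \<Longrightarrow> Reind P u \<alpha> \<in> Fib P X"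
    and Reind_mono: "u \<in> hom C X Y \<Longrightarrow> (\<alpha>, \<beta>) \<in> Le P Y \<Longrightarrow> (Reind P u \<alpha>, Reind P u \<beta>) \<in> Le P X"
    and Reind_Ide: "X \<in> Obj C \<Longrightarrow> \<alpha> \<in> Fib P X \<Longrightarrow> Reind P (Ide C X) \<alpha> = \<alpha>"
    and Reind_Cmp: "u \<in> hom C X Y \<Longrightarrow> v \<in> hom C Y Z \<Longrightarrow> \<alpha> \<in> Fib P Z \<Longrightarrow>
      Reind P (Cmp C v u) \<alpha> = Reind P u (Reind P v \<alpha>)"

definition isomorphic_doctrines ::
  "('o, 'm) cat \<Rightarrow> ('o, 'm, 'p) indexed_poset \<Rightarrow> ('o, 'm, 'q) indexed_poset \<Rightarrow> bool" where
  "isomorphic_doctrines C P Q \<longleftrightarrow> doctrine C P \<and> doctrine C Q \<and>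
     (\<exists>\<theta>. (\<forall>X\<in>Obj C. bij_betw (\<theta> X) (Fib P X) (Fib Q X) \<and>
              (\<forall>\<alpha>\<in>Fib P X. \<forall>\<beta>\<in>Fib P X. (\<alpha>, \<beta>) \<in> Le P X \<longleftrightarrow> (\<theta> X \<alpha>, \<theta> X \<beta>) \<in> Le Q X)) \<and>
          (\<forall>u\<in>Arr C. \<forall>\<alpha>\<in>Fib P (Cod C u).
              \<theta> (Dom C u) (Reind P u \<alpha>) = Reind Q u (\<theta> (Cod C u) \<alpha>)))"

text \<open>Fibrewise poset reflection of preorders \<open>r X\<close> on \<open>S X\<close>, with the action of \<open>u\<close> on classes
  induced by the action \<open>act u\<close> on representatives.\<close>

definition iso_rel :: "'x rel \<Rightarrow> 'x rel" where
  "iso_rel r = r \<inter> r\<inverse>"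

definition poset_reflection ::
  "('o, 'm) cat \<Rightarrow> ('o \<Rightarrow> 'x set) \<Rightarrow> ('o \<Rightarrow> 'x rel) \<Rightarrow> ('m \<Rightarrow> 'x \<Rightarrow> 'x) \<Rightarrow>
     ('o, 'm, 'x set) indexed_poset" where
  "poset_reflection C S r act =
     \<lparr>Fib = (\<lambda>X. S X // iso_rel (r X)),
      Le = (\<lambda>X. {(c, d). c \<in> S X // iso_rel (r X) \<and> d \<in> S X // iso_rel (r X) \<and>
                         (\<exists>x\<in>c. \<exists>y\<in>d. (x, y) \<in> r X)}),
      Reind = (\<lambda>u c. \<Union>x\<in>c. iso_rel (r (Dom C u)) `` {act u x})\<rparr>"


section \<open>The full existential completion\<close>

definition ex_obj :: "('o, 'm) cat \<Rightarrow> ('o, 'm, 'p) indexed_poset \<Rightarrow> 'o \<Rightarrow> ('m \<times> 'p) set" where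
  "ex_obj C P X = {(f, \<alpha>). f \<in> Arr C \<and> Cod C f = X \<and> \<alpha> \<in> Fib P (Dom C f)}"

definition ex_le :: "('o, 'm) cat \<Rightarrow> ('o, 'm, 'p) indexed_poset \<Rightarrow> 'o \<Rightarrow> ('m \<times> 'p) rel" where
  "ex_le C P X = {((f, \<alpha>), (g, \<beta>)). (f, \<alpha>) \<in> ex_obj C P X \<and> (g, \<beta>) \<in> ex_obj C P X \<and>
     (\<exists>h\<in>hom C (Dom C f) (Dom C g). Cmp C g h = f \<and> (\<alpha>, Reind P h \<beta>) \<in> Le P (Dom C f))}"

definition pullback_choice :: "('o, 'm) cat \<Rightarrow> 'm \<Rightarrow> 'm \<Rightarrow> 'm \<times> 'm" where
  "pullback_choice C u g = (SOME (p, q). is_pullback C u g p q)"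

definition ex_act :: "('o, 'm) cat \<Rightarrow> ('o, 'm, 'p) indexed_poset \<Rightarrow> 'm \<Rightarrow> 'm \<times> 'p \<Rightarrow> 'm \<times> 'p" where
  "ex_act C P u = (\<lambda>(g, \<beta>). let (p, q) = pullback_choice C u g in (p, Reind P q \<beta>))"

definition full_ex_completion ::
  "('o, 'm) cat \<Rightarrow> ('o, 'm, 'p) indexed_poset \<Rightarrow> ('o, 'm, ('m \<times> 'p) set) indexed_poset" where
  "full_ex_completion C P = poset_reflection C (ex_obj C P) (ex_le C P) (ex_act C P)"


section \<open>The category of sets\<close>

text \<open>HOL has no type of all sets, so \<open>Set\<close> is the category of the small sets of an arbitrary
  universe: a collection \<open>U\<close> of subsets of a type \<open>'u\<close>. Only the closure properties that make
  finite limits available are required. A Grothendieck universe (or a model of set theory, with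
  the collections of elements of its sets as small sets) is an instance, and so is the
  collection of all subsets of an infinite type. Closure under power sets is not demanded: HOL
  does not prove that a universe with an infinite member and closed under power sets exists.\<close>

definition set_universe :: "'u set set \<Rightarrow> bool" where
  "set_universe U \<longleftrightarrow>
     (\<exists>X\<in>U. X \<noteq> {}) \<and>
     (\<forall>X\<in>U. \<forall>Y. Y \<subseteq> X \<longrightarrow> Y \<in> U) \<and>
     (\<forall>X\<in>U. \<forall>Y\<in>U. \<exists>e :: 'u \<times> 'u \<Rightarrow> 'u. inj_on e (X \<times> Y) \<and> e ` (X \<times> Y) \<in> U)"

lemma set_universe_UNIV:
  assumes "infinite (UNIV :: 'u set)"
  shows "set_universe (UNIV :: 'u set set)"
proof -
  note card_of_Times_same_infinite[OF assms]
  then obtain e :: "'u \<times> 'u \<Rightarrow> 'u" where "bij_betw e (UNIV \<times> UNIV) UNIV"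
    using card_of_ordIso by blast
  then have "inj_on e (X \<times> Y)" for X Y
    by (meson bij_betw_imp_inj_on inj_on_subset Sigma_mono subset_UNIV)
  then show ?thesis
    unfolding set_universe_def by auto
qed

text \<open>\<open>\<wp>(\<A>)\<close> is, up to bijection, a small set.\<close>

definition small_powerset :: "'u set set \<Rightarrow> 'a itself \<Rightarrow> bool" where
  "small_powerset U _ \<longleftrightarrow> (\<exists>e :: 'a set \<Rightarrow> 'u. inj e \<and> range e \<in> U)"

type_synonym 'u set_arr = "'u set \<times> ('u \<Rightarrow> 'u) \<times> 'u set"

definition set_cat :: "'u set set \<Rightarrow> ('u set, 'u set_arr) cat" where
  "set_cat U =
     \<lparr>Obj = U,
      Arr = {(X, f, Y). X \<in> U \<and> Y \<in> U \<and> f \<in> X \<rightarrow>\<^sub>E Y},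
      Dom = (\<lambda>(X, f, Y). X),
      Cod = (\<lambda>(X, f, Y). Y),
      Ide = (\<lambda>X. (X, (\<lambda>x\<in>X. x), X)),
      Cmp = (\<lambda>(Y, g, Z) (X, f, Y'). (X, compose X g f, Z))\<rparr>"

abbreviation fn :: "'u set_arr \<Rightarrow> 'u \<Rightarrow> 'u" where
  "fn u \<equiv> fst (snd u)"

lemma hom_set_cat:
  "a \<in> hom (set_cat U) X Y \<longleftrightarrow> X \<in> U \<and> Y \<in> U \<and> (\<exists>f \<in> X \<rightarrow>\<^sub>E Y. a = (X, f, Y))"
  unfolding hom_def set_cat_def by auto

lemma Cmp_set_cat [simp]: "Cmp (set_cat U) (Y, g, Z) (X, f, Y') = (X, compose X g f, Z)"
  by (simp add: set_cat_def)

lemma Ide_set_cat: "Ide (set_cat U) X = (X, (\<lambda>x\<in>X. x), X)"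
  by (simp add: set_cat_def)

lemma category_set_cat: "category (set_cat U)"
proof
  show "Dom (set_cat U) f \<in> Obj (set_cat U)" if "f \<in> Arr (set_cat U)" for f
    using that by (auto simp: set_cat_def)
  show "Cod (set_cat U) f \<in> Obj (set_cat U)" if "f \<in> Arr (set_cat U)" for f
    using that by (auto simp: set_cat_def)
  show "Ide (set_cat U) X \<in> hom (set_cat U) X X" if "X \<in> Obj (set_cat U)" for X
    using that by (auto simp: set_cat_def hom_def)
  show "Cmp (set_cat U) g f \<in> hom (set_cat U) X Z"
    if "f \<in> hom (set_cat U) X Y" "g \<in> hom (set_cat U) Y Z" for f g X Y Z
    using that by (fastforce simp: hom_set_cat compose_def PiE_iff)
  show "Cmp (set_cat U) f (Ide (set_cat U) X) = f" if "f \<in> hom (set_cat U) X Y" for f X Y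
    using that
    by (auto simp: hom_set_cat Ide_set_cat compose_def fun_eq_iff PiE_def extensional_def)
  show "Cmp (set_cat U) (Ide (set_cat U) Y) f = f" if "f \<in> hom (set_cat U) X Y" for f X Y
    using that
    by (auto simp: hom_set_cat Ide_set_cat compose_def fun_eq_iff PiE_def extensional_def)
  show "Cmp (set_cat U) h (Cmp (set_cat U) g f) = Cmp (set_cat U) (Cmp (set_cat U) h g) f"
    if "f \<in> hom (set_cat U) W X" "g \<in> hom (set_cat U) X Y" "h \<in> hom (set_cat U) Y Z"
    for f g h W X Y Z
    using that by (auto simp: hom_set_cat compose_def fun_eq_iff PiE_def)
qed

lemma has_pullbacks_set_cat:
  fixes U :: "'u set set"
  assumes U: "set_universe U"
  shows "has_pullbacks (set_cat U)"
  unfolding has_pullbacks_def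
proof (intro ballI impI)
  fix u g assume u: "u \<in> Arr (set_cat U)" and g: "g \<in> Arr (set_cat U)"
    and eq: "Cod (set_cat U) u = Cod (set_cat U) g"
  obtain X k Z where u': "u = (X, k, Z)" and X: "X \<in> U" and k: "k \<in> X \<rightarrow>\<^sub>E Z"
    using u by (auto simp: set_cat_def)
  obtain Y l where g': "g = (Y, l, Z)" and Y: "Y \<in> U" and l: "l \<in> Y \<rightarrow>\<^sub>E Z"
    using g eq u' by (auto simp: set_cat_def)
  obtain e :: "'u \<times> 'u \<Rightarrow> 'u" where inj: "inj_on e (X \<times> Y)" and im: "e ` (X \<times> Y) \<in> U"
    using U X Y unfolding set_universe_def by metis
  define B where "B = {(x, y) \<in> X \<times> Y. k x = l y}"
  define D where "D = e ` B"
  have D: "D \<in> U"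
  proof -
    have "D \<subseteq> e ` (X \<times> Y)"
      by (auto simp: D_def B_def)
    then show ?thesis
      using U im unfolding set_universe_def by blast
  qed
  define i where "i = inv_into (X \<times> Y) e"
  have i: "i (e z) = z" if "z \<in> B" for z
    using that inj by (auto simp: i_def B_def)
  define p where "p = (D, (\<lambda>d\<in>D. fst (i d)), X)"
  define q where "q = (D, (\<lambda>d\<in>D. snd (i d)), Y)"
  have dom: "Dom (set_cat U) u = X" "Dom (set_cat U) g = Y" "Dom (set_cat U) p = D"
    by (auto simp: set_cat_def u' g' p_def)
  have pq: "p \<in> hom (set_cat U) D X" "q \<in> hom (set_cat U) D Y"
    using D X Y i by (auto simp: hom_set_cat p_def q_def D_def B_def)
  have sq: "Cmp (set_cat U) u p = Cmp (set_cat U) g q"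
    using i by (auto simp: u' g' p_def q_def compose_def fun_eq_iff D_def B_def)
  have univ: "\<exists>!h. h \<in> hom (set_cat U) W D \<and> Cmp (set_cat U) p h = f \<and> Cmp (set_cat U) q h = f'"
    if f: "f \<in> hom (set_cat U) W X" and f': "f' \<in> hom (set_cat U) W Y"
      and comm: "Cmp (set_cat U) u f = Cmp (set_cat U) g f'" for W f f'
  proof -
    obtain m where m: "f = (W, m, X)" "m \<in> W \<rightarrow>\<^sub>E X" "W \<in> U"
      using f by (auto simp: hom_set_cat)
    obtain n where n: "f' = (W, n, Y)" "n \<in> W \<rightarrow>\<^sub>E Y"
      using f' by (auto simp: hom_set_cat)
    have mn: "(m w, n w) \<in> B" if "w \<in> W" for w
      using comm that m n by (auto simp: u' g' B_def compose_def fun_eq_iff) metis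
    have tup: "(\<lambda>w\<in>W. e (m w, n w)) \<in> W \<rightarrow>\<^sub>E D"
      using mn by (auto simp: D_def)
    show ?thesis
    proof (rule ex1I)
      show "(W, (\<lambda>w\<in>W. e (m w, n w)), D) \<in> hom (set_cat U) W D \<and>
        Cmp (set_cat U) p (W, (\<lambda>w\<in>W. e (m w, n w)), D) = f \<and>
        Cmp (set_cat U) q (W, (\<lambda>w\<in>W. e (m w, n w)), D) = f'"
      proof (intro conjI)
        show "(W, (\<lambda>w\<in>W. e (m w, n w)), D) \<in> hom (set_cat U) W D"
          using tup m D by (auto simp: hom_set_cat)
        show "Cmp (set_cat U) p (W, (\<lambda>w\<in>W. e (m w, n w)), D) = f"
          using m mn i
          by (auto simp: p_def D_def compose_def fun_eq_iff PiE_def extensional_def)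
        show "Cmp (set_cat U) q (W, (\<lambda>w\<in>W. e (m w, n w)), D) = f'"
          using n mn i
          by (auto simp: q_def D_def compose_def fun_eq_iff PiE_def extensional_def)
      qed
    next
      fix h assume h: "h \<in> hom (set_cat U) W D \<and>
        Cmp (set_cat U) p h = f \<and> Cmp (set_cat U) q h = f'"
      then obtain t where t: "h = (W, t, D)" "t \<in> W \<rightarrow>\<^sub>E D"
        by (auto simp: hom_set_cat)
      have "t w = e (m w, n w)" if w: "w \<in> W" for w
      proof -
        obtain z where z: "z \<in> B" "t w = e z"
          using t w unfolding D_def by (metis PiE_mem imageE)
        have "fst z = m w" "snd z = n w"
          using h w z i[OF z(1)] m n t
          by (auto simp: p_def q_def compose_def D_def fun_eq_iff split: if_splits) (metis image_eqI)+
        then show ?thesis using z by (metis prod.collapse)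
      qed
      then have "t = (\<lambda>w\<in>W. e (m w, n w))"
        using t by (auto simp: fun_eq_iff PiE_def extensional_def)
      then show "h = (W, (\<lambda>w\<in>W. e (m w, n w)), D)"
        using t by simp
    qed
  qed
  show "\<exists>p q. is_pullback (set_cat U) u g p q"
    unfolding is_pullback_def using pq sq univ dom by metis
qed


section \<open>Partial combinatory algebras\<close>

text \<open>The underlying set of the algebra is the type \<open>'a\<close>; \<open>app a b = None\<close> means that \<open>a b\<close> is
  undefined. Compound applications are strict.\<close>

type_synonym 'a papp = "'a \<Rightarrow> 'a \<Rightarrow> 'a option"

definition app_strict :: "'a papp \<Rightarrow> 'a option \<Rightarrow> 'a option \<Rightarrow> 'a option" where
  "app_strict app x y = Option.bind x (\<lambda>a. Option.bind y (app a))"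

text \<open>\<open>x \<simeq> y\<close> in its directed reading: if \<open>y\<close> is defined then so is \<open>x\<close>, and they agree.\<close>

definition refines :: "'a option \<Rightarrow> 'a option \<Rightarrow> bool" where
  "refines x y \<longleftrightarrow> (y \<noteq> None \<longrightarrow> x = y)"

definition is_k :: "'a papp \<Rightarrow> 'a \<Rightarrow> bool" where
  "is_k app k \<longleftrightarrow> (\<forall>a b. app k a \<noteq> None \<and> refines (app_strict app (app k a) (Some b)) (Some a))"

definition is_s :: "'a papp \<Rightarrow> 'a \<Rightarrow> bool" where
  "is_s app s \<longleftrightarrow> (\<forall>a b c.
     app s a \<noteq> None \<and>
     app_strict app (app s a) (Some b) \<noteq> None \<and>
     refines (app_strict app (app_strict app (app s a) (Some b)) (Some c))
             (app_strict app (app a c) (app b c)))"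

definition pca :: "'a papp \<Rightarrow> bool" where
  "pca app \<longleftrightarrow> (\<exists>k s. is_k app k \<and> is_s app s)"

definition elementary_sub_pca :: "'a papp \<Rightarrow> 'a set \<Rightarrow> bool" where
  "elementary_sub_pca app A' \<longleftrightarrow>
     (\<forall>a\<in>A'. \<forall>b\<in>A'. \<forall>c. app a b = Some c \<longrightarrow> c \<in> A') \<and>
     (\<exists>k\<in>A'. \<exists>s\<in>A'. is_k app k \<and> is_s app s)"

definition app_in :: "'a papp \<Rightarrow> 'a \<Rightarrow> 'a \<Rightarrow> 'a set \<Rightarrow> bool" where
  "app_in app a b S \<longleftrightarrow> (\<exists>c\<in>S. app a b = Some c)"


section \<open>The Medvedev doctrine\<close>

definition med_obj :: "'u set \<Rightarrow> ('u \<Rightarrow> 'a set) set" where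
  "med_obj X = X \<rightarrow>\<^sub>E UNIV"

definition med_le :: "'a papp \<Rightarrow> 'a set \<Rightarrow> 'u set \<Rightarrow> ('u \<Rightarrow> 'a set) rel" where
  "med_le app A' X = {(\<phi>, \<psi>). \<phi> \<in> med_obj X \<and> \<psi> \<in> med_obj X \<and>
     (\<exists>a\<in>A'. \<forall>x\<in>X. \<forall>b\<in>\<psi> x. app_in app a b (\<phi> x))}"

definition med_act :: "'u set_arr \<Rightarrow> ('u \<Rightarrow> 'a set) \<Rightarrow> ('u \<Rightarrow> 'a set)" where
  "med_act u \<phi> = (\<lambda>x\<in>fst u. \<phi> (fn u x))"

definition medvedev ::
  "'a papp \<Rightarrow> 'a set \<Rightarrow> 'u set set \<Rightarrow> ('u set, 'u set_arr, ('u \<Rightarrow> 'a set) set) indexed_poset" where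
  "medvedev app A' U = poset_reflection (set_cat U) med_obj (med_le app A') med_act"


section \<open>The doctrine \<open>\<DD>\<close>\<close>

text \<open>A function \<open>F: R \<rightarrow> \<wp>(\<A>)\<close> with \<open>R \<subseteq> X \<times> \<wp>(\<A>)\<close> is the pair \<open>(R, F)\<close>, with \<open>F\<close>
  extensional on \<open>R\<close>.\<close>

type_synonym ('u, 'a) d_elem = "('u \<times> 'a set) set \<times> ('u \<times> 'a set \<Rightarrow> 'a set)"

definition d_obj :: "'u set \<Rightarrow> ('u, 'a) d_elem set" where
  "d_obj X = {(R, F). R \<subseteq> X \<times> UNIV \<and> F \<in> R \<rightarrow>\<^sub>E UNIV}"

definition d_le :: "'a papp \<Rightarrow> 'a set \<Rightarrow> 'u set \<Rightarrow> ('u, 'a) d_elem rel" where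
  "d_le app A' X = {((R, F), (S, G)). (R, F) \<in> d_obj X \<and> (S, G) \<in> d_obj X \<and>
     (\<exists>\<phi> :: 'u \<times> 'a set \<Rightarrow> 'a set. \<exists>h\<in>A'. \<forall>(x, A)\<in>R.
        (x, \<phi> (x, A)) \<in> S \<and> (\<forall>q\<in>G (x, \<phi> (x, A)). app_in app h q (F (x, A))))}"

definition d_act :: "'u set_arr \<Rightarrow> ('u, 'a) d_elem \<Rightarrow> ('u, 'a) d_elem" where
  "d_act u = (\<lambda>(R, F). let R' = {(x, A). x \<in> fst u \<and> (fn u x, A) \<in> R}
                       in (R', \<lambda>(x, A)\<in>R'. F (fn u x, A)))"

definition doctrine_D ::
  "'a papp \<Rightarrow> 'a set \<Rightarrow> 'u set set \<Rightarrow> ('u set, 'u set_arr, ('u, 'a) d_elem set) indexed_poset" where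
  "doctrine_D app A' U = poset_reflection (set_cat U) d_obj (d_le app A') d_act"

end

theory Submission
  imports Defs
begin

text \<open>A pair \<open>(g: C \<rightarrow> X, \<beta>)\<close> is sent to the relation \<open>{(g c, \<beta> c) | c \<in> C}\<close> with the second
  projection as function to \<open>\<wp>(\<A>)\<close>. Realizing \<open>(f, \<alpha>) \<le> (g, \<beta>)\<close> only requires choosing, for each
  \<open>b\<close>, some \<open>c\<close> over the same point whose \<open>\<beta> c\<close> is mapped into \<open>\<alpha> b\<close>, and whether \<open>c\<close> is suitable
  depends on \<open>(g c, \<beta> c)\<close> only; hence the assignment is an order embedding. It is essentially
  surjective because \<open>F: R \<rightarrow> \<wp>(\<A>)\<close> is equivalent to the image of the projection \<open>R \<rightarrow> X\<close> together
  with \<open>F\<close>, where \<open>R\<close> is small since \<open>\<wp>(\<A>)\<close> is. The laws of the completion are transported from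
  \<open>\<DD>\<close> along this embedding.\<close>

section \<open>Poset reflections of indexed preorders\<close>

lemma iso_rel_iff: "(x, y) \<in> iso_rel r \<longleftrightarrow> (x, y) \<in> r \<and> (y, x) \<in> r"
  by (auto simp: iso_rel_def)

lemma equiv_iso_rel: "preorder_on A r \<Longrightarrow> equiv A (iso_rel r)"
  unfolding preorder_on_def
  by (intro equivI refl_onI symI transI) (auto simp: iso_rel_iff dest: refl_onD transD)

text \<open>The action laws are required only up to \<open>iso_rel\<close>: an action through chosen
  pullbacks is in general functorial only up to isomorphism, and isomorphic elements have equal
  classes.\<close>

locale indexed_preorder = category C for C :: "('o, 'm) cat" +
  fixes S :: "'o \<Rightarrow> 'x set" and r :: "'o \<Rightarrow> 'x rel" and act :: "'m \<Rightarrow> 'x \<Rightarrow> 'x"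
  assumes preorder: "X \<in> Obj C \<Longrightarrow> preorder_on (S X) (r X)"
    and act_closed: "u \<in> hom C X Y \<Longrightarrow> x \<in> S Y \<Longrightarrow> act u x \<in> S X"
    and act_mono: "u \<in> hom C X Y \<Longrightarrow> (x, y) \<in> r Y \<Longrightarrow> (act u x, act u y) \<in> r X"
    and act_Ide: "X \<in> Obj C \<Longrightarrow> x \<in> S X \<Longrightarrow> (act (Ide C X) x, x) \<in> iso_rel (r X)"
    and act_Cmp: "u \<in> hom C X Y \<Longrightarrow> v \<in> hom C Y Z \<Longrightarrow> x \<in> S Z \<Longrightarrow>
      (act (Cmp C v u) x, act u (act v x)) \<in> iso_rel (r X)"
begin

abbreviation cls :: "'o \<Rightarrow> 'x \<Rightarrow> 'x set" where
  "cls X x \<equiv> iso_rel (r X) `` {x}"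

abbreviation reflection :: "('o, 'm, 'x set) indexed_poset" where
  "reflection \<equiv> poset_reflection C S r act"

lemma hom_Obj:
  assumes "u \<in> hom C X Y"
  shows "X \<in> Obj C" "Y \<in> Obj C"
  using assms Dom_Obj Cod_Obj by (auto simp: hom_def)

lemma le_closed: "X \<in> Obj C \<Longrightarrow> (x, y) \<in> r X \<Longrightarrow> x \<in> S X \<and> y \<in> S X"
  using preorder by (auto simp: preorder_on_def)

lemma le_refl: "X \<in> Obj C \<Longrightarrow> x \<in> S X \<Longrightarrow> (x, x) \<in> r X"
  using preorder by (auto simp: preorder_on_def refl_on_def)

lemma le_trans: "X \<in> Obj C \<Longrightarrow> (x, y) \<in> r X \<Longrightarrow> (y, z) \<in> r X \<Longrightarrow> (x, z) \<in> r X"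
  using preorder by (auto simp: preorder_on_def dest: transD)

lemma equiv_iso: "X \<in> Obj C \<Longrightarrow> equiv (S X) (iso_rel (r X))"
  by (simp add: equiv_iso_rel preorder)

lemma Fib_reflection: "Fib reflection X = cls X ` S X"
  by (auto simp: poset_reflection_def quotient_def)

lemma cls_in_Fib: "x \<in> S X \<Longrightarrow> cls X x \<in> Fib reflection X"
  by (auto simp: Fib_reflection)

lemma cls_eqI: "X \<in> Obj C \<Longrightarrow> (x, y) \<in> iso_rel (r X) \<Longrightarrow> cls X x = cls X y"
  by (meson equiv_class_eq equiv_iso)

lemma cls_eq_iff:
  "X \<in> Obj C \<Longrightarrow> x \<in> S X \<Longrightarrow> y \<in> S X \<Longrightarrow> cls X x = cls X y \<longleftrightarrow> (x, y) \<in> iso_rel (r X)"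
  by (meson eq_equiv_class_iff equiv_iso)

lemma mem_cls: "X \<in> Obj C \<Longrightarrow> x \<in> S X \<Longrightarrow> x \<in> cls X x"
  by (simp add: iso_rel_iff le_refl)

text \<open>\<open>Le\<close> asks only for some related pair of representatives; transitivity
  carries the relation to any other pair in the same classes.\<close>

lemma Le_cls:
  assumes X: "X \<in> Obj C" and x: "x \<in> S X" and y: "y \<in> S X"
  shows "(cls X x, cls X y) \<in> Le reflection X \<longleftrightarrow> (x, y) \<in> r X"
proof
  assume "(cls X x, cls X y) \<in> Le reflection X"
  then obtain x' y' where "(x, x') \<in> r X" "(x', y') \<in> r X" "(y', y) \<in> r X"
    by (auto simp: poset_reflection_def iso_rel_iff)
  then show "(x, y) \<in> r X"
    using le_trans X by metis
next
  assume "(x, y) \<in> r X"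
  then show "(cls X x, cls X y) \<in> Le reflection X"
    using mem_cls[OF X x] mem_cls[OF X y] x y
    by (auto simp: poset_reflection_def quotient_def)
qed

lemma Le_Fib: "(c, d) \<in> Le reflection X \<Longrightarrow> c \<in> Fib reflection X \<and> d \<in> Fib reflection X"
  by (auto simp: poset_reflection_def)

lemma act_iso: "u \<in> hom C X Y \<Longrightarrow> (x, y) \<in> iso_rel (r Y) \<Longrightarrow> (act u x, act u y) \<in> iso_rel (r X)"
  by (simp add: iso_rel_iff act_mono)

text \<open>\<open>Reind\<close> is a union over all elements of the class. By
  \<open>act_iso\<close> its terms are one and the same class, and at least one term is present
  because \<open>x\<close> lies in its own class.\<close>

lemma Reind_cls:
  assumes u: "u \<in> hom C X Y" and x: "x \<in> S Y"
  shows "Reind reflection u (cls Y x) = cls X (act u x)"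
proof -
  have "Dom C u = X"
    using u by (simp add: hom_def)
  moreover have "cls X (act u y) = cls X (act u x)" if "y \<in> cls Y x" for y
    using that act_iso[OF u] hom_Obj[OF u] by (metis Image_singleton_iff cls_eqI)
  moreover have "x \<in> cls Y x"
    using mem_cls hom_Obj[OF u] x by blast
  ultimately show ?thesis
    unfolding poset_reflection_def indexed_poset.simps by blast
qed

text \<open>\<open>Le_cls\<close> and \<open>Reind_cls\<close> reduce each law to representatives;
  the laws that hold there up to \<open>iso_rel\<close> become equalities of classes.\<close>

lemma doctrine_reflection:
  assumes "has_finite_products C"
  shows "doctrine C reflection"
proof
  show "has_finite_products C"
    by fact
  show "partial_order_on (Fib reflection X) (Le reflection X)" if X: "X \<in> Obj C" for X
    unfolding partial_order_on_def preorder_on_def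
  proof (intro conjI)
    show "Le reflection X \<subseteq> Fib reflection X \<times> Fib reflection X"
      using Le_Fib by auto
    show "refl_on (Fib reflection X) (Le reflection X)"
      using X by (auto simp: refl_on_def Fib_reflection Le_cls le_refl)
    show "trans (Le reflection X)"
    proof (rule transI)
      fix a b c
      assume ab: "(a, b) \<in> Le reflection X" and bc: "(b, c) \<in> Le reflection X"
      obtain x y z where "x \<in> S X" "y \<in> S X" "z \<in> S X" "a = cls X x" "b = cls X y" "c = cls X z"
        using Le_Fib[OF ab] Le_Fib[OF bc] by (auto simp: Fib_reflection)
      then show "(a, c) \<in> Le reflection X"
        using ab bc X by (metis Le_cls le_trans)
    qed
    show "antisym (Le reflection X)"
    proof (rule antisymI)
      fix a b
      assume ab: "(a, b) \<in> Le reflection X" and ba: "(b, a) \<in> Le reflection X"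
      obtain x y where "x \<in> S X" "y \<in> S X" "a = cls X x" "b = cls X y"
        using Le_Fib[OF ab] by (auto simp: Fib_reflection)
      then show "a = b"
        using ab ba X by (metis Le_cls cls_eqI iso_rel_iff)
    qed
  qed
  show "Reind reflection u \<alpha> \<in> Fib reflection X"
    if "u \<in> hom C X Y" "\<alpha> \<in> Fib reflection Y" for u X Y \<alpha>
    using that by (auto simp: Fib_reflection Reind_cls act_closed)
  show "(Reind reflection u \<alpha>, Reind reflection u \<beta>) \<in> Le reflection X"
    if u: "u \<in> hom C X Y" and le: "(\<alpha>, \<beta>) \<in> Le reflection Y" for u X Y \<alpha> \<beta>
  proof -
    obtain x y where "x \<in> S Y" "y \<in> S Y" "\<alpha> = cls Y x" "\<beta> = cls Y y"
      using Le_Fib[OF le] by (auto simp: Fib_reflection)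
    then show ?thesis
      using u le hom_Obj[OF u] by (simp add: Reind_cls Le_cls act_closed act_mono)
  qed
  show "Reind reflection (Ide C X) \<alpha> = \<alpha>" if X: "X \<in> Obj C" and \<alpha>: "\<alpha> \<in> Fib reflection X" for X \<alpha>
  proof -
    obtain x where "x \<in> S X" "\<alpha> = cls X x"
      using \<alpha> by (auto simp: Fib_reflection)
    then show ?thesis
      using Reind_cls[OF Ide_hom[OF X]] cls_eqI[OF X act_Ide[OF X]] by simp
  qed
  show "Reind reflection (Cmp C v u) \<alpha> = Reind reflection u (Reind reflection v \<alpha>)"
    if u: "u \<in> hom C X Y" and v: "v \<in> hom C Y Z" and \<alpha>: "\<alpha> \<in> Fib reflection Z" for u v X Y Z \<alpha>
  proof -
    obtain x where x: "x \<in> S Z" "\<alpha> = cls Z x"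
      using \<alpha> by (auto simp: Fib_reflection)
    then show ?thesis
      using Reind_cls[OF Cmp_hom[OF u v] x(1)] Reind_cls[OF v x(1)]
        Reind_cls[OF u act_closed[OF v x(1)]] cls_eqI[OF _ act_Cmp[OF u v x(1)]] hom_Obj[OF u]
      by simp
  qed
qed

end

section \<open>Transport of doctrine structure along an order embedding\<close>

text \<open>On the source alone only closure is assumed: its preorder and functoriality laws are
  reflected from the target along \<open>m\<close>. For the full existential completion this avoids
  comparing iterated chosen pullbacks.\<close>

locale indexed_embedding = target: indexed_preorder C T q act'
  for C :: "('o, 'm) cat" and T :: "'o \<Rightarrow> 'y set" and q :: "'o \<Rightarrow> 'y rel"
    and act' :: "'m \<Rightarrow> 'y \<Rightarrow> 'y" +
  fixes S :: "'o \<Rightarrow> 'x set" and r :: "'o \<Rightarrow> 'x rel" and act :: "'m \<Rightarrow> 'x \<Rightarrow> 'x"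
    and m :: "'o \<Rightarrow> 'x \<Rightarrow> 'y"
  assumes source_closed: "X \<in> Obj C \<Longrightarrow> r X \<subseteq> S X \<times> S X"
    and m_closed: "X \<in> Obj C \<Longrightarrow> x \<in> S X \<Longrightarrow> m X x \<in> T X"
    and m_embedding: "X \<in> Obj C \<Longrightarrow> x \<in> S X \<Longrightarrow> y \<in> S X \<Longrightarrow> (x, y) \<in> r X \<longleftrightarrow> (m X x, m X y) \<in> q X"
    and source_act: "u \<in> hom C X Y \<Longrightarrow> x \<in> S Y \<Longrightarrow> act u x \<in> S X"
    and m_natural: "u \<in> hom C X Y \<Longrightarrow> x \<in> S Y \<Longrightarrow> (m X (act u x), act' u (m Y x)) \<in> iso_rel (q X)"
begin

lemma m_iso:
  "X \<in> Obj C \<Longrightarrow> x \<in> S X \<Longrightarrow> y \<in> S X \<Longrightarrow> (x, y) \<in> iso_rel (r X) \<longleftrightarrow> (m X x, m X y) \<in> iso_rel (q X)"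
  by (simp add: iso_rel_iff m_embedding)

lemma iso_trans:
  "X \<in> Obj C \<Longrightarrow> (x, y) \<in> iso_rel (q X) \<Longrightarrow> (y, z) \<in> iso_rel (q X) \<Longrightarrow> (x, z) \<in> iso_rel (q X)"
  by (meson equivE target.equiv_iso transD)

lemma iso_sym: "(x, y) \<in> iso_rel (q X) \<Longrightarrow> (y, x) \<in> iso_rel (q X)"
  by (simp add: iso_rel_iff)

text \<open>Since \<open>m\<close> reflects the order, each law may be checked after applying
  \<open>m\<close>, where naturality replaces \<open>act\<close> by \<open>act'\<close> and the law
  of the target applies.\<close>

sublocale source: indexed_preorder C S r act
proof
  show "preorder_on (S X) (r X)" if X: "X \<in> Obj C" for X
    unfolding preorder_on_def
  proof (intro conjI)
    show "r X \<subseteq> S X \<times> S X"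
      by (rule source_closed[OF X])
    show "refl_on (S X) (r X)"
      using X by (auto simp: refl_on_def m_embedding target.le_refl m_closed)
    show "trans (r X)"
    proof (rule transI)
      fix x y z assume xy: "(x, y) \<in> r X" and yz: "(y, z) \<in> r X"
      then have "x \<in> S X" "y \<in> S X" "z \<in> S X"
        using source_closed[OF X] by auto
      then show "(x, z) \<in> r X"
        using xy yz X target.le_trans by (metis m_embedding)
    qed
  qed
  show "act u x \<in> S X" if "u \<in> hom C X Y" "x \<in> S Y" for u X Y x
    using source_act that .
  show "(act u x, act u y) \<in> r X" if u: "u \<in> hom C X Y" and le: "(x, y) \<in> r Y" for u X Y x y
  proof -
    note obj = target.hom_Obj[OF u]
    have xy: "x \<in> S Y" "y \<in> S Y"
      using source_closed[OF obj(2)] le by auto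
    have "(m X (act u x), act' u (m Y x)) \<in> q X" "(act' u (m Y y), m X (act u y)) \<in> q X"
      using m_natural[OF u] xy by (auto simp: iso_rel_iff)
    moreover have "(act' u (m Y x), act' u (m Y y)) \<in> q X"
      using target.act_mono[OF u] m_embedding[OF obj(2) xy] le by simp
    ultimately have "(m X (act u x), m X (act u y)) \<in> q X"
      using target.le_trans[OF obj(1)] by metis
    then show ?thesis
      using m_embedding[OF obj(1)] source_act[OF u] xy by simp
  qed
  show "(act (Ide C X) x, x) \<in> iso_rel (r X)" if X: "X \<in> Obj C" and x: "x \<in> S X" for X x
  proof -
    note id = target.Ide_hom[OF X]
    have "(m X (act (Ide C X) x), m X x) \<in> iso_rel (q X)"
      using iso_trans[OF X m_natural[OF id x] target.act_Ide[OF X m_closed[OF X x]]] .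
    then show ?thesis
      using m_iso[OF X source_act[OF id x] x] by simp
  qed
  show "(act (Cmp C v u) x, act u (act v x)) \<in> iso_rel (r X)"
    if u: "u \<in> hom C X Y" and v: "v \<in> hom C Y Z" and x: "x \<in> S Z" for u v X Y Z x
  proof -
    have X: "X \<in> Obj C" and Z: "Z \<in> Obj C"
      using target.hom_Obj u v by auto
    note vu = target.Cmp_hom[OF u v]
    \<comment> \<open>The chain passes through \<open>act' u (act' v (m Z x))\<close>; naturality is
      used once for the composite and once for each of \<open>v\<close> and
      \<open>u\<close>.\<close>
    have "(m X (act (Cmp C v u) x), act' u (act' v (m Z x))) \<in> iso_rel (q X)"
      using iso_trans[OF X m_natural[OF vu x] target.act_Cmp[OF u v m_closed[OF Z x]]] .
    moreover have "(act' u (act' v (m Z x)), act' u (m Y (act v x))) \<in> iso_rel (q X)"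
      using target.act_iso[OF u] iso_sym[OF m_natural[OF v x]] .
    moreover have "(act' u (m Y (act v x)), m X (act u (act v x))) \<in> iso_rel (q X)"
      using iso_sym[OF m_natural[OF u source_act[OF v x]]] .
    ultimately have "(m X (act (Cmp C v u) x), m X (act u (act v x))) \<in> iso_rel (q X)"
      using iso_trans[OF X] by metis
    then show ?thesis
      using m_iso[OF X source_act[OF vu x] source_act[OF u source_act[OF v x]]] by simp
  qed
qed

text \<open>Preserving and reflecting \<open>iso_rel\<close> makes the map of classes well defined
  and injective, \<open>ess_surj\<close> makes it onto, and naturality up to \<open>iso_rel\<close>
  becomes strict on classes.\<close>

lemma isomorphic_reflections:
  assumes fp: "has_finite_products C"
    and ess_surj: "\<And>X y. X \<in> Obj C \<Longrightarrow> y \<in> T X \<Longrightarrow> \<exists>x\<in>S X. (m X x, y) \<in> iso_rel (q X)"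
  shows "isomorphic_doctrines C source.reflection target.reflection"
proof -
  \<comment> \<open>The union avoids a choice of representative: for a class \<open>c\<close> all
    the classes united coincide, because \<open>m\<close> preserves \<open>iso_rel\<close>.\<close>
  define \<theta> where "\<theta> X c = (\<Union>x\<in>c. target.cls X (m X x))" for X c
  have \<theta>: "\<theta> X (source.cls X x) = target.cls X (m X x)" if X: "X \<in> Obj C" and x: "x \<in> S X" for X x
  proof -
    have "target.cls X (m X y) = target.cls X (m X x)" if "y \<in> source.cls X x" for y
    proof -
      have "(x, y) \<in> iso_rel (r X)" "y \<in> S X"
        using that source.le_closed[OF X] by (auto simp: iso_rel_iff)
      then show ?thesis
        using target.cls_eqI[OF X] m_iso[OF X x] by metis
    qed
    then show ?thesis
      unfolding \<theta>_def using source.mem_cls[OF X x] by blast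
  qed
  show ?thesis
    unfolding isomorphic_doctrines_def
  proof (intro conjI exI[of _ \<theta>] ballI)
    show "doctrine C source.reflection" "doctrine C target.reflection"
      using source.doctrine_reflection target.doctrine_reflection fp by auto
    fix X assume X: "X \<in> Obj C"
    show "bij_betw (\<theta> X) (Fib source.reflection X) (Fib target.reflection X)"
      unfolding bij_betw_def
    proof (intro conjI)
      show "inj_on (\<theta> X) (Fib source.reflection X)"
        using X
        by (auto simp: inj_on_def source.Fib_reflection \<theta> m_closed target.cls_eq_iff
            source.cls_eq_iff m_iso)
      show "\<theta> X ` Fib source.reflection X = Fib target.reflection X"
      proof
        show "\<theta> X ` Fib source.reflection X \<subseteq> Fib target.reflection X"
          using X m_closed by (auto simp: source.Fib_reflection target.Fib_reflection \<theta>)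
        show "Fib target.reflection X \<subseteq> \<theta> X ` Fib source.reflection X"
        proof
          fix d assume "d \<in> Fib target.reflection X"
          then obtain y where y: "y \<in> T X" "d = target.cls X y"
            by (auto simp: target.Fib_reflection)
          then obtain x where x: "x \<in> S X" "(m X x, y) \<in> iso_rel (q X)"
            using ess_surj X by blast
          then have "d = \<theta> X (source.cls X x)"
            using target.cls_eqI[OF X] \<theta>[OF X] y by metis
          then show "d \<in> \<theta> X ` Fib source.reflection X"
            using source.cls_in_Fib x(1) by blast
        qed
      qed
    qed
    fix \<alpha> \<beta>
    assume "\<alpha> \<in> Fib source.reflection X" "\<beta> \<in> Fib source.reflection X"
    then show "(\<alpha>, \<beta>) \<in> Le source.reflection X \<longleftrightarrow> (\<theta> X \<alpha>, \<theta> X \<beta>) \<in> Le target.reflection X"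
      using X by (auto simp: source.Fib_reflection \<theta> source.Le_cls target.Le_cls m_closed m_embedding)
  next
    fix u \<alpha> assume u: "u \<in> Arr C" and \<alpha>: "\<alpha> \<in> Fib source.reflection (Cod C u)"
    define X Y where "X = Dom C u" and "Y = Cod C u"
    have hom: "u \<in> hom C X Y"
      using u by (simp add: hom_def X_def Y_def)
    note obj = target.hom_Obj[OF hom]
    obtain x where x: "x \<in> S Y" "\<alpha> = source.cls Y x"
      using \<alpha> by (auto simp: source.Fib_reflection Y_def)
    have "\<theta> X (Reind source.reflection u \<alpha>) = target.cls X (m X (act u x))"
      using x \<theta>[OF obj(1) source_act[OF hom x(1)]] source.Reind_cls[OF hom x(1)] by simp
    also have "\<dots> = target.cls X (act' u (m Y x))"
      using target.cls_eqI[OF obj(1) m_natural[OF hom x(1)]] .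
    also have "\<dots> = Reind target.reflection u (\<theta> Y \<alpha>)"
      using x \<theta>[OF obj(2) x(1)] target.Reind_cls[OF hom m_closed[OF obj(2) x(1)]] by simp
    finally show "\<theta> (Dom C u) (Reind source.reflection u \<alpha>) = Reind target.reflection u (\<theta> (Cod C u) \<alpha>)"
      by (simp add: X_def Y_def)
  qed
qed

end

section \<open>Sets and partial combinatory algebras\<close>

text \<open>A binary product is a pullback over a terminal object: parallel arrows into
  \<open>T\<close> are equal, so every pair of arrows to \<open>X\<close> and \<open>Y\<close> is a
  cone.\<close>

lemma (in category) has_finite_products_if_pullbacks:
  assumes T: "is_terminal C T" and pb: "has_pullbacks C"
  shows "has_finite_products C"
  unfolding has_finite_products_def
proof (intro conjI ballI)
  show "\<exists>T. is_terminal C T"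
    using T ..
  fix X Y assume X: "X \<in> Obj C" and Y: "Y \<in> Obj C"
  obtain u g where u: "u \<in> hom C X T" and g: "g \<in> hom C Y T"
    using T X Y unfolding is_terminal_def by blast
  obtain p q where pq: "is_pullback C u g p q"
    using pb u g unfolding has_pullbacks_def hom_def by fastforce
  have dom: "Dom C u = X" "Dom C g = Y"
    using u g by (auto simp: hom_def)
  have "Dom C p \<in> Obj C"
    using pq Dom_Obj unfolding is_pullback_def hom_def by blast
  moreover have "Cmp C u f = Cmp C g f'" if "W \<in> Obj C" "f \<in> hom C W X" "f' \<in> hom C W Y" for W f f'
    using T that Cmp_hom[OF _ u] Cmp_hom[OF _ g] unfolding is_terminal_def by blast
  ultimately have "is_product C X Y (Dom C p) p q"
    using pq unfolding is_pullback_def is_product_def dom by blast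
  then show "\<exists>Z p q. is_product C X Y Z p q"
    by blast
qed

lemma set_cat_simps [simp]:
  "Obj (set_cat U) = U" "Dom (set_cat U) (X, f, Y) = X" "Cod (set_cat U) (X, f, Y) = Y"
  "(X, f, Y) \<in> Arr (set_cat U) \<longleftrightarrow> X \<in> U \<and> Y \<in> U \<and> f \<in> X \<rightarrow>\<^sub>E Y"
  by (auto simp: set_cat_def)

lemma small_singleton: "set_universe U \<Longrightarrow> X \<in> U \<Longrightarrow> x \<in> X \<Longrightarrow> {x} \<in> U"
  unfolding set_universe_def by blast

lemma has_finite_products_set_cat:
  assumes U: "set_universe U"
  shows "has_finite_products (set_cat U)"
proof -
  obtain t where t: "{t} \<in> U"
    using U small_singleton[OF U] unfolding set_universe_def by blast
  have "\<exists>!f. f \<in> hom (set_cat U) X {t}" if "X \<in> U" for X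
  proof (rule ex1I)
    show "(X, (\<lambda>x\<in>X. t), {t}) \<in> hom (set_cat U) X {t}"
      using that t by (auto simp: hom_set_cat)
    show "f = (X, (\<lambda>x\<in>X. t), {t})" if "f \<in> hom (set_cat U) X {t}" for f
      using that by (auto simp: hom_set_cat fun_eq_iff PiE_iff extensional_def)
  qed
  then have "is_terminal (set_cat U) {t}"
    using t by (simp add: is_terminal_def)
  then show ?thesis
    by (rule category.has_finite_products_if_pullbacks[OF category_set_cat _
          has_pullbacks_set_cat[OF U]])
qed

text \<open>The pullback is arbitrary, so its elements are accessible only through the universal
  property. Testing it on the one-point cone with values \<open>x\<close> and \<open>c\<close>
  yields an arrow from \<open>{x}\<close> whose value is the required \<open>d\<close>.\<close>

lemma pullback_point:
  assumes U: "set_universe U"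
    and pb: "is_pullback (set_cat U) (X', k, X) (C, l, X) (D, p, X') (D, q, C)"
    and X': "X' \<in> U" and C: "C \<in> U" and x: "x \<in> X'" and c: "c \<in> C" and eq: "k x = l c"
  shows "\<exists>d\<in>D. p d = x \<and> q d = c"
proof -
  define f where "f = ({x}, (\<lambda>_\<in>{x}. x), X')"
  define f' where "f' = ({x}, (\<lambda>_\<in>{x}. c), C)"
  have W: "{x} \<in> U"
    by (rule small_singleton[OF U X' x])
  have f: "f \<in> hom (set_cat U) {x} X'" "f' \<in> hom (set_cat U) {x} C"
    using W X' C x c by (auto simp: f_def f'_def hom_set_cat)
  have comm: "Cmp (set_cat U) (X', k, X) f = Cmp (set_cat U) (C, l, X) f'"
    using eq by (auto simp: f_def f'_def compose_def fun_eq_iff)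
  obtain h where h: "h \<in> hom (set_cat U) {x} D"
    "Cmp (set_cat U) (D, p, X') h = f" "Cmp (set_cat U) (D, q, C) h = f'"
    using pb W f comm unfolding is_pullback_def by (auto dest!: bspec ex1_implies_ex)
  obtain t where t: "h = ({x}, t, D)" "t \<in> {x} \<rightarrow>\<^sub>E D"
    using h(1) by (auto simp: hom_set_cat)
  have "compose {x} p t x = x" "compose {x} q t x = c"
    using h(2,3) by (auto simp: t(1) f_def f'_def)
  then show ?thesis
    using t(2) by (auto simp: compose_def)
qed

section \<open>Identity and composition combinators\<close>

lemma is_kE:
  assumes "is_k app k"
  obtains ka where "app k a = Some ka" "\<And>b. app ka b = Some a"
proof -
  obtain ka where ka: "app k a = Some ka"
    using assms unfolding is_k_def by blast
  have "refines (app_strict app (app k a) (Some b)) (Some a)" for b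
    using assms unfolding is_k_def by blast
  then have "app ka b = Some a" for b
    by (simp add: ka app_strict_def refines_def)
  then show ?thesis
    using that ka by blast
qed

lemma is_sE:
  assumes "is_s app s"
  obtains sa sab where "app s a = Some sa" "app sa b = Some sab"
    "\<And>c. refines (app sab c) (app_strict app (app a c) (app b c))"
proof -
  obtain sa where sa: "app s a = Some sa"
    using assms unfolding is_s_def by blast
  have "app_strict app (app s a) (Some b) \<noteq> None"
    using assms unfolding is_s_def by blast
  then obtain sab where sab: "app sa b = Some sab"
    by (auto simp: sa app_strict_def)
  have "refines (app_strict app (app_strict app (app s a) (Some b)) (Some c))
      (app_strict app (app a c) (app b c))" for c
    using assms unfolding is_s_def by blast
  then have "refines (app sab c) (app_strict app (app a c) (app b c))" for c
    by (simp add: sa sab app_strict_def)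
  then show ?thesis
    using that sa sab by blast
qed

text \<open>The witness is \<open>s k k\<close>: the expression \<open>k a (k a)\<close> is defined
  with value \<open>a\<close>, and \<open>refines\<close> passes this value on to
  \<open>s k k a\<close>.\<close>

lemma elementary_sub_pca_identity:
  assumes "elementary_sub_pca app A'"
  shows "\<exists>i\<in>A'. \<forall>a. app i a = Some a"
proof -
  obtain k s where ks: "k \<in> A'" "s \<in> A'" "is_k app k" "is_s app s"
    and cl: "\<And>a b c. a \<in> A' \<Longrightarrow> b \<in> A' \<Longrightarrow> app a b = Some c \<Longrightarrow> c \<in> A'"
    using assms unfolding elementary_sub_pca_def by blast
  obtain sk i where i: "app s k = Some sk" "app sk k = Some i"
    "\<And>a. refines (app i a) (app_strict app (app k a) (app k a))"
    using is_sE[OF ks(4)] by metis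
  have "app i a = Some a" for a
  proof -
    obtain ka where "app k a = Some ka" "\<And>b. app ka b = Some a"
      using is_kE[OF ks(3)] by metis
    then show ?thesis
      using i(3)[of a] by (simp add: app_strict_def refines_def)
  qed
  then show ?thesis
    using cl ks(1,2) i(1,2) by blast
qed

text \<open>\<open>s (k a) b\<close> composes \<open>a\<close> with \<open>b\<close>.\<close>

lemma elementary_sub_pca_compose:
  assumes "elementary_sub_pca app A'" and a: "a \<in> A'" and b: "b \<in> A'"
  shows "\<exists>c\<in>A'. \<forall>x y z. app b x = Some y \<longrightarrow> app a y = Some z \<longrightarrow> app c x = Some z"
proof -
  obtain k s where ks: "k \<in> A'" "s \<in> A'" "is_k app k" "is_s app s"
    and cl: "\<And>a b c. a \<in> A' \<Longrightarrow> b \<in> A' \<Longrightarrow> app a b = Some c \<Longrightarrow> c \<in> A'"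
    using assms unfolding elementary_sub_pca_def by blast
  obtain ka where ka: "app k a = Some ka" "\<And>b. app ka b = Some a"
    using is_kE[OF ks(3)] by metis
  obtain sa c where c: "app s ka = Some sa" "app sa b = Some c"
    "\<And>x. refines (app c x) (app_strict app (app ka x) (app b x))"
    using is_sE[OF ks(4)] by metis
  have "app c x = Some z" if "app b x = Some y" "app a y = Some z" for x y z
    using c(3)[of x] that by (simp add: ka(2) app_strict_def refines_def)
  moreover have "c \<in> A'"
    using cl ks(1,2) ka(1) c(1,2) a b by blast
  ultimately show ?thesis
    by blast
qed

section \<open>The comparison map\<close>

text \<open>The realizer \<open>h\<close> is fixed before the points, and \<open>\<phi>\<close> is
  an arbitrary function; by choice it can be traded for the existence of a suitable \<open>B\<close>
  at each pair.\<close>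

lemma d_le_iff:
  fixes R S :: "('u \<times> 'a set) set"
  shows "((R, F), (S, G)) \<in> d_le app A' X \<longleftrightarrow> (R, F) \<in> d_obj X \<and> (S, G) \<in> d_obj X \<and>
     (\<exists>h\<in>A'. \<forall>x A. (x, A) \<in> R \<longrightarrow> (\<exists>B. (x, B) \<in> S \<and> (\<forall>q\<in>G (x, B). app_in app h q (F (x, A)))))"
proof -
  have skolem: "(\<exists>\<phi> :: 'u \<times> 'a set \<Rightarrow> 'a set. \<forall>(x, A)\<in>R.
          (x, \<phi> (x, A)) \<in> S \<and> (\<forall>q\<in>G (x, \<phi> (x, A)). app_in app h q (F (x, A)))) \<longleftrightarrow>
        (\<forall>x A. (x, A) \<in> R \<longrightarrow> (\<exists>B. (x, B) \<in> S \<and> (\<forall>q\<in>G (x, B). app_in app h q (F (x, A)))))"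
    (is "?l \<longleftrightarrow> ?r") for h
  proof
    show "?l \<Longrightarrow> ?r"
      by blast
    assume ?r
    then have "\<forall>z\<in>R. \<exists>B. (fst z, B) \<in> S \<and> (\<forall>q\<in>G (fst z, B). app_in app h q (F z))"
      by auto
    then obtain \<phi> where
      "\<forall>z\<in>R. (fst z, \<phi> z) \<in> S \<and> (\<forall>q\<in>G (fst z, \<phi> z). app_in app h q (F z))"
      by metis
    then show ?l
      by (intro exI[of _ \<phi>]) auto
  qed
  show ?thesis
    unfolding d_le_def skolem[symmetric] mem_Collect_eq case_prod_conv by blast
qed

text \<open>The image forgets how often a pair \<open>(fn g c, \<phi> c)\<close> is attained.
  Restricting \<open>snd\<close> gives the extensional function that \<open>d_obj\<close> demands,
  so the relation determines the whole element.\<close>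

definition d_of :: "'u set_arr \<Rightarrow> ('u \<Rightarrow> 'a set) \<Rightarrow> ('u, 'a) d_elem" where
  "d_of g \<phi> = (let R = (\<lambda>c. (fn g c, \<phi> c)) ` fst g in (R, restrict snd R))"

lemma d_of_closed: "l \<in> C \<rightarrow>\<^sub>E X \<Longrightarrow> d_of (C, l, X) \<phi> \<in> d_obj X"
  by (auto simp: d_of_def d_obj_def Let_def)

text \<open>\<open>R\<close> is a set of pairs outside the universe and has to be replaced by a
  small copy. On this copy the first projection serves as the arrow and \<open>F\<close> as the
  predicate; the resulting relation has the values of \<open>F\<close> in place of the labels
  \<open>A\<close>.\<close>

lemma d_of_surj:
  fixes R :: "('u \<times> 'a set) set"
  assumes U: "set_universe U" and P: "small_powerset U TYPE('a)"
    and X: "X \<in> U" and RF: "(R, F) \<in> d_obj X"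
  shows "\<exists>C l \<phi>. C \<in> U \<and> l \<in> C \<rightarrow>\<^sub>E X \<and> \<phi> \<in> med_obj C \<and>
    fst (d_of (C, l, X) \<phi>) = {(x, F (x, A)) |x A. (x, A) \<in> R}"
proof -
  obtain e :: "'a set \<Rightarrow> 'u" where e: "inj e" "range e \<in> U"
    using P unfolding small_powerset_def by blast
  obtain e2 :: "'u \<times> 'u \<Rightarrow> 'u" where e2: "inj_on e2 (X \<times> range e)" "e2 ` (X \<times> range e) \<in> U"
    using U X e(2) unfolding set_universe_def by metis
  \<comment> \<open>\<open>e\<close> codes subsets of the algebra by elements of a small set and
    \<open>e2\<close> codes pairs, so \<open>j\<close> sends \<open>R\<close> injectively into a
    small set.\<close>
  define j where "j z = e2 (fst z, e (snd z))" for z :: "'u \<times> 'a set"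
  have RX: "fst z \<in> X" if "z \<in> R" for z
    using RF that by (auto simp: d_obj_def)
  have "inj_on j R"
  proof (rule inj_onI)
    fix z w assume "z \<in> R" "w \<in> R" "j z = j w"
    then have "(fst z, e (snd z)) = (fst w, e (snd w))"
      using RX by (intro inj_onD[OF e2(1)]) (auto simp: j_def)
    then show "z = w"
      using e(1) by (simp add: inj_eq prod_eq_iff)
  qed
  then have inv: "inv_into R j (j z) = z" if "z \<in> R" for z
    using that by simp
  have "j ` R \<subseteq> e2 ` (X \<times> range e)"
    using RX by (auto simp: j_def)
  then have C: "j ` R \<in> U"
    using U e2(2) unfolding set_universe_def by blast
  define l where "l = (\<lambda>c\<in>j ` R. fst (inv_into R j c))"
  define \<phi> where "\<phi> = (\<lambda>c\<in>j ` R. F (inv_into R j c))"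
  have "l \<in> j ` R \<rightarrow>\<^sub>E X" "\<phi> \<in> med_obj (j ` R)"
    using RX inv by (auto simp: l_def \<phi>_def med_obj_def)
  moreover have "(\<lambda>c. (l c, \<phi> c)) ` j ` R = {(x, F (x, A)) |x A. (x, A) \<in> R}"
    using inv by (force simp: l_def \<phi>_def image_image)
  then have "fst (d_of (j ` R, l, X) \<phi>) = {(x, F (x, A)) |x A. (x, A) \<in> R}"
    by (simp add: d_of_def Let_def)
  ultimately show ?thesis
    using C by blast
qed

text \<open>Reindexing the image keeps the pairs \<open>(x, \<phi> c)\<close> with
  \<open>k x = l c\<close>, and these are the ones attained on the pullback. The equality is strict
  and holds for every pullback, hence for the one selected in \<open>ex_act\<close>.\<close>

lemma d_act_d_of:
  assumes U: "set_universe U"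
    and pb: "is_pullback (set_cat U) (X', k, X) (C, l, X) (D, p, X') (D, q, C)"
    and X': "X' \<in> U" and C: "C \<in> U"
  shows "d_act (X', k, X) (d_of (C, l, X) \<phi>) = d_of (D, p, X') (med_act (D, q, C) \<phi>)"
proof -
  have p: "p \<in> D \<rightarrow>\<^sub>E X'" and q: "q \<in> D \<rightarrow>\<^sub>E C"
    and "compose D k p = compose D l q"
    using pb by (auto simp: is_pullback_def hom_set_cat)
  then have sq: "k (p d) = l (q d)" if "d \<in> D" for d
    using that by (metis compose_eq)
  define R where "R = (\<lambda>c. (l c, \<phi> c)) ` C"
  define R' where "R' = {(x, A). x \<in> X' \<and> (k x, A) \<in> R}"
  have "R' = (\<lambda>d. (p d, \<phi> (q d))) ` D"
  proof
    \<comment> \<open>This inclusion rests on the universal property, the converse on the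
      commutativity of the square.\<close>
    show "R' \<subseteq> (\<lambda>d. (p d, \<phi> (q d))) ` D"
    proof
      fix z assume "z \<in> R'"
      then obtain x c where x: "x \<in> X'" "c \<in> C" "k x = l c" "z = (x, \<phi> c)"
        by (auto simp: R'_def R_def)
      then obtain d where "d \<in> D" "p d = x" "q d = c"
        using pullback_point[OF U pb X' C] by blast
      then show "z \<in> (\<lambda>d. (p d, \<phi> (q d))) ` D"
        using x by auto
    qed
    show "(\<lambda>d. (p d, \<phi> (q d))) ` D \<subseteq> R'"
      using p q sq by (auto simp: R'_def R_def)
  qed
  also have "\<dots> = (\<lambda>d. (p d, med_act (D, q, C) \<phi> d)) ` D"
    by (auto simp: med_act_def)
  finally have R': "R' = (\<lambda>d. (p d, med_act (D, q, C) \<phi> d)) ` D" .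
  have "d_act (X', k, X) (d_of (C, l, X) \<phi>) = (R', \<lambda>(x, A)\<in>R'. restrict snd R (k x, A))"
    by (simp add: d_act_def d_of_def Let_def R_def R'_def)
  also have "(\<lambda>(x, A)\<in>R'. restrict snd R (k x, A)) = restrict snd R'"
    by (auto simp: fun_eq_iff R'_def)
  also have "(R', restrict snd R') = d_of (D, p, X') (med_act (D, q, C) \<phi>)"
    by (simp add: d_of_def Let_def flip: R')
  finally show ?thesis .
qed

text \<open>Both sides say that a single \<open>a\<close> maps, for each \<open>b\<close>, the set
  \<open>\<psi> c\<close> into \<open>\<phi> b\<close> for some \<open>c\<close> over
  \<open>k b\<close>. Choosing \<open>c\<close> as a function of \<open>b\<close> gives
  \<open>h\<close>, and \<open>l c = k b\<close> is its compatibility with the arrows to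
  \<open>X\<close>.\<close>

lemma d_of_le:
  assumes "B \<in> U" "k \<in> B \<rightarrow>\<^sub>E X" "C \<in> U" "l \<in> C \<rightarrow>\<^sub>E X" "\<phi> \<in> med_obj B"
  shows "(d_of (B, k, X) \<phi>, d_of (C, l, X) \<psi>) \<in> d_le app A' X \<longleftrightarrow>
    (\<exists>h\<in>hom (set_cat U) B C. Cmp (set_cat U) (C, l, X) h = (B, k, X) \<and>
       (\<phi>, med_act h \<psi>) \<in> med_le app A' B)" (is "?l \<longleftrightarrow> ?r")
proof -
  define R where "R = (\<lambda>b. (k b, \<phi> b)) ` B"
  define S where "S = (\<lambda>c. (l c, \<psi> c)) ` C"
  \<comment> \<open>Different \<open>c\<close> may give the same pair, but the requirement depends
    on the pair alone, so quantifying over \<open>S\<close> amounts to quantifying over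
    \<open>C\<close>.\<close>
  have S: "(\<exists>Y. (x, Y) \<in> S \<and> (\<forall>q\<in>restrict snd S (x, Y). Q q)) \<longleftrightarrow>
      (\<exists>c\<in>C. l c = x \<and> (\<forall>q\<in>\<psi> c. Q q))" for x Q
    by (fastforce simp: S_def)
  have R: "(\<forall>x Y. (x, Y) \<in> R \<longrightarrow> Q x Y) \<longleftrightarrow> (\<forall>b\<in>B. Q (k b) (\<phi> b))" for Q
    by (fastforce simp: R_def)
  have "(R, restrict snd R) \<in> d_obj X" "(S, restrict snd S) \<in> d_obj X"
    using d_of_closed[OF assms(2), of \<phi>] d_of_closed[OF assms(4), of \<psi>]
    by (simp_all add: d_of_def Let_def R_def S_def)
  then have "((R, restrict snd R), (S, restrict snd S)) \<in> d_le app A' X \<longleftrightarrow>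
      (\<exists>a\<in>A'. \<forall>b\<in>B. \<exists>c\<in>C. l c = k b \<and> (\<forall>q\<in>\<psi> c. app_in app a q (\<phi> b)))"
    unfolding d_le_iff S by (simp add: R)
  then have "?l \<longleftrightarrow> (\<exists>a\<in>A'. \<forall>b\<in>B. \<exists>c\<in>C. l c = k b \<and> (\<forall>q\<in>\<psi> c. app_in app a q (\<phi> b)))"
    by (simp add: d_of_def Let_def R_def S_def)
  also have "\<dots> \<longleftrightarrow> ?r"
  proof
    assume "\<exists>a\<in>A'. \<forall>b\<in>B. \<exists>c\<in>C. l c = k b \<and> (\<forall>q\<in>\<psi> c. app_in app a q (\<phi> b))"
    then obtain a t where a: "a \<in> A'"
      and t: "\<forall>b\<in>B. t b \<in> C \<and> l (t b) = k b \<and> (\<forall>q\<in>\<psi> (t b). app_in app a q (\<phi> b))"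
      by metis
    define h where "h = (B, restrict t B, C)"
    have "h \<in> hom (set_cat U) B C"
      using assms t by (auto simp: hom_set_cat h_def)
    moreover have "Cmp (set_cat U) (C, l, X) h = (B, k, X)"
      using assms(2) t by (auto simp: h_def compose_def fun_eq_iff PiE_iff extensional_def)
    moreover have "(\<phi>, med_act h \<psi>) \<in> med_le app A' B"
      using assms(5) a t by (auto simp: med_le_def med_act_def med_obj_def h_def)
    ultimately show ?r
      by blast
  next
    assume ?r
    then obtain t a where t: "t \<in> B \<rightarrow>\<^sub>E C" "compose B l t = k" and a: "a \<in> A'"
      and r: "\<forall>b\<in>B. \<forall>q\<in>\<psi> (t b). app_in app a q (\<phi> b)"
      by (auto simp: hom_set_cat med_le_def med_act_def)
    have "t b \<in> C \<and> l (t b) = k b" if "b \<in> B" for b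
      using t that by (auto simp: compose_def)
    then show "\<exists>a\<in>A'. \<forall>b\<in>B. \<exists>c\<in>C. l c = k b \<and> (\<forall>q\<in>\<psi> c. app_in app a q (\<phi> b))"
      using a r by blast
  qed
  finally show ?thesis .
qed

section \<open>The two indexed preorders over sets\<close>

locale sub_pca_universe =
  fixes app :: "'a papp" and A' :: "'a set" and U :: "'u set set"
  assumes sub_pca: "elementary_sub_pca app A'" and universe: "set_universe U"
begin

text \<open>One identity combinator works for all sets \<open>S\<close> at once, so reflexivity of
  both orders has a realizer independent of the point.\<close>

lemma app_in_identity: "\<exists>i\<in>A'. \<forall>S. \<forall>a\<in>S. app_in app i a S"
  using elementary_sub_pca_identity[OF sub_pca] by (auto simp: app_in_def)

text \<open>\<open>c\<close> is found before \<open>x\<close>, \<open>S\<close> and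
  \<open>T\<close>: transitivity needs one realizer for all points.\<close>

lemma app_in_compose:
  assumes "a \<in> A'" "b \<in> A'"
  shows "\<exists>c\<in>A'. \<forall>x S T. app_in app b x S \<longrightarrow> (\<forall>y\<in>S. app_in app a y T) \<longrightarrow> app_in app c x T"
  using elementary_sub_pca_compose[OF sub_pca assms] unfolding app_in_def by metis

lemma med_act_Ide: "\<phi> \<in> med_obj X \<Longrightarrow> med_act (Ide (set_cat U) X) \<phi> = \<phi>"
  by (auto simp: med_act_def Ide_set_cat med_obj_def fun_eq_iff PiE_iff extensional_def)

lemma d_act_Ide:
  assumes "z \<in> d_obj X"
  shows "d_act (Ide (set_cat U) X) z = z"
proof -
  obtain R F where z: "z = (R, F)" and R: "R \<subseteq> X \<times> UNIV" and F: "F \<in> extensional R"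
    using assms by (auto simp: d_obj_def PiE_def)
  have "{(x, A). x \<in> X \<and> ((\<lambda>x\<in>X. x) x, A) \<in> R} = R"
    using R by auto
  moreover have "(\<lambda>(x, A)\<in>R. F ((\<lambda>x\<in>X. x) x, A)) = F"
    using R F by (force simp: fun_eq_iff extensional_def)
  ultimately show ?thesis
    by (simp only: z d_act_def Ide_set_cat fst_conv snd_conv case_prod_conv Let_def)
qed

lemma preorder_med: "preorder_on (med_obj X) (med_le app A' X :: ('u \<Rightarrow> 'a set) rel)"
  unfolding preorder_on_def
proof (intro conjI transI)
  show "med_le app A' X \<subseteq> med_obj X \<times> med_obj X"
    by (auto simp: med_le_def)
  show "refl_on (med_obj X) (med_le app A' X)"
  proof (rule refl_onI)
    obtain i where "i \<in> A'" "\<forall>S. \<forall>a\<in>S. app_in app i a S"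
      using app_in_identity by blast
    then show "(\<phi>, \<phi>) \<in> med_le app A' X" if "\<phi> \<in> med_obj X" for \<phi> :: "'u \<Rightarrow> 'a set"
      using that unfolding med_le_def by blast
  qed
  fix \<phi> \<psi> \<chi> :: "'u \<Rightarrow> 'a set"
  assume 1: "(\<phi>, \<psi>) \<in> med_le app A' X" and 2: "(\<psi>, \<chi>) \<in> med_le app A' X"
  obtain a where a: "a \<in> A'" "\<forall>x\<in>X. \<forall>b\<in>\<psi> x. app_in app a b (\<phi> x)"
    using 1 by (auto simp: med_le_def)
  obtain b where b: "b \<in> A'" "\<forall>x\<in>X. \<forall>c\<in>\<chi> x. app_in app b c (\<psi> x)"
    using 2 by (auto simp: med_le_def)
  \<comment> \<open>Realizers run against the order: \<open>b\<close> takes \<open>\<chi> x\<close>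
    into \<open>\<psi> x\<close> and \<open>a\<close> takes \<open>\<psi> x\<close> into
    \<open>\<phi> x\<close>, so \<open>c\<close> applies \<open>b\<close> first.\<close>
  obtain c where "c \<in> A'"
    "\<forall>x S T. app_in app b x S \<longrightarrow> (\<forall>y\<in>S. app_in app a y T) \<longrightarrow> app_in app c x T"
    using app_in_compose[OF a(1) b(1)] by blast
  then have "c \<in> A' \<and> (\<forall>x\<in>X. \<forall>q\<in>\<chi> x. app_in app c q (\<phi> x))"
    using a(2) b(2) by blast
  then show "(\<phi>, \<chi>) \<in> med_le app A' X"
    using 1 2 by (auto simp: med_le_def)
qed

lemma preorder_d: "preorder_on (d_obj X) (d_le app A' X :: ('u, 'a) d_elem rel)"
  unfolding preorder_on_def
proof (intro conjI transI)
  show "d_le app A' X \<subseteq> d_obj X \<times> d_obj X"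
    by (auto simp: d_le_def)
  show "refl_on (d_obj X) (d_le app A' X)"
  proof (rule refl_onI)
    obtain i where "i \<in> A'" "\<forall>S. \<forall>a\<in>S. app_in app i a S"
      using app_in_identity by blast
    then show "(z, z) \<in> d_le app A' X" if "z \<in> d_obj X" for z :: "('u, 'a) d_elem"
      using that by (cases z) (simp only: d_le_iff, blast)
  qed
  fix x y z :: "('u, 'a) d_elem"
  assume 1: "(x, y) \<in> d_le app A' X" and 2: "(y, z) \<in> d_le app A' X"
  obtain R F S G T H where xyz: "x = (R, F)" "y = (S, G)" "z = (T, H)"
    by (metis prod.exhaust)
  obtain a where a: "a \<in> A'"
    "\<forall>x A. (x, A) \<in> R \<longrightarrow> (\<exists>B. (x, B) \<in> S \<and> (\<forall>q\<in>G (x, B). app_in app a q (F (x, A))))"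
    using 1 by (auto simp: d_le_iff xyz)
  obtain b where b: "b \<in> A'"
    "\<forall>x A. (x, A) \<in> S \<longrightarrow> (\<exists>B. (x, B) \<in> T \<and> (\<forall>q\<in>H (x, B). app_in app b q (G (x, A))))"
    using 2 by (auto simp: d_le_iff xyz)
  obtain c where c: "c \<in> A'"
    "\<forall>x S T. app_in app b x S \<longrightarrow> (\<forall>y\<in>S. app_in app a y T) \<longrightarrow> app_in app c x T"
    using app_in_compose[OF a(1) b(1)] by blast
  have "\<exists>B. (x, B) \<in> T \<and> (\<forall>q\<in>H (x, B). app_in app c q (F (x, A)))" if "(x, A) \<in> R" for x A
    using a(2) b(2) c(2) that by metis
  then show "(x, z) \<in> d_le app A' X"
    using 1 2 c(1) by (auto simp: d_le_iff xyz)
qed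

text \<open>A realizer is uniform in the points, so it survives precomposition. The action laws hold
  as equalities, which reflexivity turns into \<open>iso_rel\<close>.\<close>

sublocale med: indexed_preorder "set_cat U" med_obj "med_le app A'" med_act
proof (rule indexed_preorder.intro[OF category_set_cat], unfold_locales)
  fix u v :: "'u set_arr" and X Y Z and \<phi> \<psi> :: "'u \<Rightarrow> 'a set"
  show "preorder_on (med_obj X) (med_le app A' X :: ('u \<Rightarrow> 'a set) rel)"
    by (rule preorder_med)
  show act: "med_act u \<phi> \<in> med_obj X" if "u \<in> hom (set_cat U) X Y" for \<phi> :: "'u \<Rightarrow> 'a set" and u X Y
    using that by (auto simp: hom_set_cat med_act_def med_obj_def)
  show "(med_act u \<phi>, med_act u \<psi>) \<in> med_le app A' X"
    if u: "u \<in> hom (set_cat U) X Y" and le: "(\<phi>, \<psi>) \<in> med_le app A' Y"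
    using le act[OF u] u by (fastforce simp: med_le_def med_act_def hom_set_cat)
  show "(med_act (Ide (set_cat U) X) \<phi>, \<phi>) \<in> iso_rel (med_le app A' X)" if "\<phi> \<in> med_obj X"
    using that preorder_med by (auto simp: med_act_Ide iso_rel_iff preorder_on_def refl_on_def)
  show "(med_act (Cmp (set_cat U) v u) \<phi>, med_act u (med_act v \<phi>)) \<in> iso_rel (med_le app A' X)"
    if u: "u \<in> hom (set_cat U) X Y" and v: "v \<in> hom (set_cat U) Y Z"
  proof -
    have "med_act (Cmp (set_cat U) v u) \<phi> = med_act u (med_act v \<phi>)"
      using u v by (auto simp: med_act_def hom_set_cat fun_eq_iff compose_def)
    then show ?thesis
      using act[OF u] preorder_med by (auto simp: iso_rel_iff preorder_on_def refl_on_def)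
  qed
qed

sublocale dd: indexed_preorder "set_cat U" d_obj "d_le app A'" d_act
proof (rule indexed_preorder.intro[OF category_set_cat], unfold_locales)
  fix u v :: "'u set_arr" and X Y Z and x y :: "('u, 'a) d_elem"
  show "preorder_on (d_obj X) (d_le app A' X :: ('u, 'a) d_elem rel)"
    by (rule preorder_d)
  show act: "d_act u x \<in> d_obj X" if "u \<in> hom (set_cat U) X Y" for x :: "('u, 'a) d_elem" and u X Y
    using that by (auto simp: hom_set_cat d_act_def d_obj_def Let_def split: prod.split)
  show "(d_act u x, d_act u y) \<in> d_le app A' X"
    if u: "u \<in> hom (set_cat U) X Y" and le: "(x, y) \<in> d_le app A' Y"
  proof -
    obtain R F S G where xy: "x = (R, F)" "y = (S, G)"
      by (metis prod.exhaust)
    \<comment> \<open>Reindexing leaves the labels unchanged, so the same \<open>h\<close>, and the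
      \<open>B\<close> found over \<open>fn u x\<close>, can be used over \<open>x\<close>.\<close>
    obtain h where "h \<in> A'"
      "\<forall>x A. (x, A) \<in> R \<longrightarrow> (\<exists>B. (x, B) \<in> S \<and> (\<forall>q\<in>G (x, B). app_in app h q (F (x, A))))"
      using le by (auto simp: d_le_iff xy)
    then show ?thesis
      using act[OF u, of x] act[OF u, of y] u
      by (fastforce simp: xy d_act_def Let_def d_le_iff hom_set_cat)
  qed
  show "(d_act (Ide (set_cat U) X) x, x) \<in> iso_rel (d_le app A' X)" if "x \<in> d_obj X"
    using that preorder_d by (auto simp: d_act_Ide iso_rel_iff preorder_on_def refl_on_def)
  show "(d_act (Cmp (set_cat U) v u) x, d_act u (d_act v x)) \<in> iso_rel (d_le app A' X)"
    if u: "u \<in> hom (set_cat U) X Y" and v: "v \<in> hom (set_cat U) Y Z"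
  proof -
    have "d_act (Cmp (set_cat U) v u) x = d_act u (d_act v x)"
      using u v
      by (auto simp: d_act_def hom_set_cat fun_eq_iff compose_def Let_def split: prod.split)
    then show ?thesis
      using act[OF u] preorder_d by (auto simp: iso_rel_iff preorder_on_def refl_on_def)
  qed
qed

section \<open>The comparison on the full existential completion\<close>

text \<open>Elements of the Medvedev fibres are classes, whereas \<open>d_of\<close> takes a
  function. A representative is chosen; by \<open>d_of_iso\<close> another choice changes the result
  only up to isomorphism.\<close>

definition rep :: "('u \<Rightarrow> 'a set) set \<Rightarrow> 'u \<Rightarrow> 'a set" where
  "rep \<beta> = (SOME \<phi>. \<phi> \<in> \<beta>)"

lemma medvedev_reflection: "medvedev app A' U = med.reflection"
  by (simp add: medvedev_def)

lemma rep_Fib: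
  assumes X: "X \<in> U" and \<beta>: "\<beta> \<in> Fib (medvedev app A' U) X"
  shows "rep \<beta> \<in> med_obj X" "\<beta> = med.cls X (rep \<beta>)"
proof -
  obtain \<phi> where \<phi>: "\<phi> \<in> med_obj X" "\<beta> = med.cls X \<phi>"
    using \<beta> by (auto simp: medvedev_reflection med.Fib_reflection)
  have "\<phi> \<in> \<beta>"
    using med.mem_cls[of X \<phi>] X \<phi> by simp
  then have "rep \<beta> \<in> \<beta>"
    unfolding rep_def some_in_eq by blast
  then have iso: "(\<phi>, rep \<beta>) \<in> iso_rel (med_le app A' X)"
    using \<phi> by simp
  then show "rep \<beta> \<in> med_obj X"
    by (simp add: iso_rel_iff med_le_def)
  show "\<beta> = med.cls X (rep \<beta>)"
    using med.cls_eqI[OF _ iso] X \<phi> by simp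
qed

lemma rep_cls: "X \<in> U \<Longrightarrow> \<phi> \<in> med_obj X \<Longrightarrow> (\<phi>, rep (med.cls X \<phi>)) \<in> iso_rel (med_le app A' X)"
  by (metis med.cls_eq_iff med.cls_in_Fib medvedev_reflection rep_Fib set_cat_simps(1))

text \<open>Equivalent functions on the same domain are compared over the identity arrow, so
  \<open>d_of_le\<close> gives both inequalities.\<close>

lemma d_of_iso:
  assumes B: "B \<in> U" and k: "k \<in> B \<rightarrow>\<^sub>E X" and iso: "(\<phi>, \<psi>) \<in> iso_rel (med_le app A' B)"
  shows "(d_of (B, k, X) \<phi>, d_of (B, k, X) \<psi>) \<in> iso_rel (d_le app A' X)"
proof -
  have "(d_of (B, k, X) \<phi>, d_of (B, k, X) \<psi>) \<in> d_le app A' X"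
    if le: "(\<phi>, \<psi>) \<in> med_le app A' B" for \<phi> \<psi> :: "'u \<Rightarrow> 'a set"
  proof -
    have obj: "\<phi> \<in> med_obj B" "\<psi> \<in> med_obj B"
      using le by (auto simp: med_le_def)
    have "Ide (set_cat U) B \<in> hom (set_cat U) B B"
      using B by (auto simp: Ide_set_cat hom_set_cat)
    moreover have "Cmp (set_cat U) (B, k, X) (Ide (set_cat U) B) = (B, k, X)"
      using k by (auto simp: Ide_set_cat compose_def fun_eq_iff PiE_iff extensional_def)
    ultimately show ?thesis
      using le obj unfolding d_of_le[OF B k B k obj(1)] by (metis med_act_Ide)
  qed
  then show ?thesis
    using iso by (simp add: iso_rel_iff)
qed

abbreviation comparison :: "'u set_arr \<times> ('u \<Rightarrow> 'a set) set \<Rightarrow> ('u, 'a) d_elem" where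
  "comparison z \<equiv> d_of (fst z) (rep (snd z))"

lemma ex_objE:
  assumes "z \<in> ex_obj (set_cat U) (medvedev app A' U) X"
  obtains B k \<alpha> where "z = ((B, k, X), \<alpha>)" "B \<in> U" "X \<in> U" "k \<in> B \<rightarrow>\<^sub>E X"
    "\<alpha> \<in> Fib (medvedev app A' U) B" "rep \<alpha> \<in> med_obj B" "\<alpha> = med.cls B (rep \<alpha>)"
  using assms rep_Fib by (cases z) (auto simp: ex_obj_def)

text \<open>On representatives the fibre inequality inside \<open>ex_le\<close> becomes
  \<open>med_le\<close>, after which \<open>d_of_le\<close> is precisely the claim.\<close>

lemma comparison_le:
  assumes x: "x \<in> ex_obj (set_cat U) (medvedev app A' U) X"
    and y: "y \<in> ex_obj (set_cat U) (medvedev app A' U) X"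
  shows "(x, y) \<in> ex_le (set_cat U) (medvedev app A' U) X \<longleftrightarrow>
    (comparison x, comparison y) \<in> d_le app A' X"
proof -
  obtain B k \<alpha> where B: "x = ((B, k, X), \<alpha>)" "B \<in> U" "X \<in> U" "k \<in> B \<rightarrow>\<^sub>E X"
    "rep \<alpha> \<in> med_obj B" "\<alpha> = med.cls B (rep \<alpha>)"
    using x by (rule ex_objE)
  obtain C l \<beta> where C: "y = ((C, l, X), \<beta>)" "C \<in> U" "l \<in> C \<rightarrow>\<^sub>E X"
    "rep \<beta> \<in> med_obj C" "\<beta> = med.cls C (rep \<beta>)"
    using y by (rule ex_objE)
  have le: "(\<alpha>, Reind (medvedev app A' U) h \<beta>) \<in> Le (medvedev app A' U) B \<longleftrightarrow>
      (rep \<alpha>, med_act h (rep \<beta>)) \<in> med_le app A' B" if h: "h \<in> hom (set_cat U) B C" for h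
  proof -
    have "Reind (medvedev app A' U) h \<beta> = med.cls B (med_act h (rep \<beta>))"
      using med.Reind_cls[OF h C(4)] C(5) by (simp add: medvedev_reflection)
    then show ?thesis
      using med.Le_cls[of B "rep \<alpha>" "med_act h (rep \<beta>)"] B(2,5,6) med.act_closed[OF h C(4)]
      by (simp add: medvedev_reflection)
  qed
  have "(x, y) \<in> ex_le (set_cat U) (medvedev app A' U) X \<longleftrightarrow>
      (\<exists>h\<in>hom (set_cat U) B C. Cmp (set_cat U) (C, l, X) h = (B, k, X) \<and>
        (\<alpha>, Reind (medvedev app A' U) h \<beta>) \<in> Le (medvedev app A' U) B)"
    using x y by (simp add: ex_le_def B(1) C(1))
  also have "\<dots> \<longleftrightarrow> (comparison x, comparison y) \<in> d_le app A' X"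
    using d_of_le[OF B(2,4) C(2,3) B(5), of "rep \<beta>" app A'] le by (simp add: B(1) C(1))
  finally show ?thesis .
qed

text \<open>With \<open>med_act Q (rep \<beta>)\<close> as function, both sides agree strictly by
  \<open>d_act_d_of\<close>. The comparison takes the chosen representative of its class instead,
  which leaves an isomorphism.\<close>

lemma ex_act_pullback:
  assumes u: "u \<in> hom (set_cat U) X Y" and x: "x \<in> ex_obj (set_cat U) (medvedev app A' U) Y"
  shows "ex_act (set_cat U) (medvedev app A' U) u x \<in> ex_obj (set_cat U) (medvedev app A' U) X"
    and "(comparison (ex_act (set_cat U) (medvedev app A' U) u x), d_act u (comparison x))
      \<in> iso_rel (d_le app A' X)"
proof -
  obtain C l \<beta> where C: "x = ((C, l, Y), \<beta>)" "C \<in> U" "Y \<in> U" "l \<in> C \<rightarrow>\<^sub>E Y"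
    "rep \<beta> \<in> med_obj C" "\<beta> = med.cls C (rep \<beta>)"
    using x by (rule ex_objE)
  obtain k where k: "u = (X, k, Y)" "X \<in> U" "k \<in> X \<rightarrow>\<^sub>E Y"
    using u by (auto simp: hom_set_cat)
  have "\<exists>p q. is_pullback (set_cat U) u (C, l, Y) p q"
    using has_pullbacks_set_cat[OF universe] C k by (simp add: has_pullbacks_def)
  then have "\<exists>z. case z of (p, q) \<Rightarrow> is_pullback (set_cat U) u (C, l, Y) p q"
    by auto
  from someI_ex[OF this] have pb: "case pullback_choice (set_cat U) u (C, l, Y) of
      (p, q) \<Rightarrow> is_pullback (set_cat U) u (C, l, Y) p q"
    unfolding pullback_choice_def .
  obtain P Q where PQ: "pullback_choice (set_cat U) u (C, l, Y) = (P, Q)"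
    by (metis prod.exhaust)
  then have PQ_pb: "is_pullback (set_cat U) u (C, l, Y) P Q"
    using pb by simp
  obtain D p q where pq: "P = (D, p, X)" "Q = (D, q, C)" "D \<in> U" "p \<in> D \<rightarrow>\<^sub>E X" "q \<in> D \<rightarrow>\<^sub>E C"
    using PQ_pb by (auto simp: is_pullback_def hom_set_cat k(1))
  have Q: "Q \<in> hom (set_cat U) D C"
    using pq C by (auto simp: hom_set_cat)
  have act: "ex_act (set_cat U) (medvedev app A' U) u x = ((D, p, X), med.cls D (med_act Q (rep \<beta>)))"
    using med.Reind_cls[OF Q C(5)] C(6)[symmetric]
    by (simp add: ex_act_def C(1) PQ medvedev_reflection flip: pq(1))
  have obj: "med_act Q (rep \<beta>) \<in> med_obj D"
    by (rule med.act_closed[OF Q C(5)])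
  show "ex_act (set_cat U) (medvedev app A' U) u x \<in> ex_obj (set_cat U) (medvedev app A' U) X"
    unfolding act using med.cls_in_Fib[OF obj] pq(3,4) k(2) by (simp add: ex_obj_def medvedev_reflection)
  have "d_act u (comparison x) = d_of (D, p, X) (med_act Q (rep \<beta>))"
    using d_act_d_of[OF universe _ k(2) C(2)] PQ_pb by (simp add: C(1) k(1) pq(1,2))
  then show "(comparison (ex_act (set_cat U) (medvedev app A' U) u x), d_act u (comparison x))
      \<in> iso_rel (d_le app A' X)"
    unfolding act using d_of_iso[OF pq(3,4) rep_cls[OF pq(3) obj]] by (simp add: iso_rel_iff)
qed

text \<open>The map is constant in the base object because \<open>d_of\<close> reads the points off
  the arrow itself.\<close>

sublocale ex: indexed_embedding "set_cat U" d_obj "d_le app A'" d_act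
  "ex_obj (set_cat U) (medvedev app A' U)" "ex_le (set_cat U) (medvedev app A' U)"
  "ex_act (set_cat U) (medvedev app A' U)" "\<lambda>_. comparison"
proof
  show "ex_le (set_cat U) (medvedev app A' U) X \<subseteq>
      ex_obj (set_cat U) (medvedev app A' U) X \<times> ex_obj (set_cat U) (medvedev app A' U) X" for X
    by (auto simp: ex_le_def)
  show "comparison x \<in> d_obj X" if "x \<in> ex_obj (set_cat U) (medvedev app A' U) X" for x X
    using that by (rule ex_objE) (simp add: d_of_closed)
qed (use comparison_le ex_act_pullback in blast)+

section \<open>Essential surjectivity and the isomorphism\<close>

text \<open>The given element and the image found by \<open>d_of_surj\<close> have the same values
  over the same points, only labelled differently; the identity combinator therefore realizes both
  inequalities.\<close>

lemma comparison_ess_surj: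
  assumes P: "small_powerset U TYPE('a)" and X: "X \<in> U" and y: "y \<in> d_obj X"
  shows "\<exists>x\<in>ex_obj (set_cat U) (medvedev app A' U) X. (comparison x, y) \<in> iso_rel (d_le app A' X)"
proof -
  obtain R F where RF: "y = (R, F)"
    by (metis prod.exhaust)
  obtain C l \<phi> where C: "C \<in> U" "l \<in> C \<rightarrow>\<^sub>E X" "\<phi> \<in> med_obj C"
    and fst: "fst (d_of (C, l, X) \<phi>) = {(x, F (x, A)) |x A. (x, A) \<in> R}"
    using d_of_surj[OF universe P X y[unfolded RF]] by blast
  define S where "S = {(x, F (x, A)) |x A. (x, A) \<in> R}"
  have d: "d_of (C, l, X) \<phi> = (S, restrict snd S)"
    using fst by (simp add: d_of_def Let_def S_def)
  have obj: "(S, restrict snd S) \<in> d_obj X" "(R, F) \<in> d_obj X"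
    using d_of_closed[OF C(2), of \<phi>] y by (simp_all add: d RF)
  obtain i where i: "i \<in> A'" "\<forall>S. \<forall>a\<in>S. app_in app i a S"
    using app_in_identity by blast
  have S: "(x, B) \<in> S \<longleftrightarrow> (\<exists>A. (x, A) \<in> R \<and> B = F (x, A))" for x B
    by (auto simp: S_def)
  have "((S, restrict snd S), (R, F)) \<in> d_le app A' X"
    unfolding d_le_iff using obj i by (intro conjI bexI[of _ i]) (auto simp: S)
  moreover have "((R, F), (S, restrict snd S)) \<in> d_le app A' X"
    unfolding d_le_iff
  proof (intro conjI bexI[of _ i] allI impI)
    fix x A assume "(x, A) \<in> R"
    then show "\<exists>B. (x, B) \<in> S \<and> (\<forall>q\<in>restrict snd S (x, B). app_in app i q (F (x, A)))"
      using i(2) by (intro exI[of _ "F (x, A)"]) (auto simp: S)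
  qed (use obj i in auto)
  ultimately have "(d_of (C, l, X) \<phi>, y) \<in> iso_rel (d_le app A' X)"
    by (simp add: d RF iso_rel_iff)
  \<comment> \<open>The comparison sees only the class of \<open>\<phi>\<close>, whose chosen
    representative may differ from \<open>\<phi>\<close>.\<close>
  moreover have "(d_of (C, l, X) (rep (med.cls C \<phi>)), d_of (C, l, X) \<phi>) \<in> iso_rel (d_le app A' X)"
    using d_of_iso[OF C(1,2) rep_cls[OF C(1,3)]] by (simp add: iso_rel_iff)
  ultimately have "(comparison ((C, l, X), med.cls C \<phi>), y) \<in> iso_rel (d_le app A' X)"
    using ex.iso_trans X by simp
  moreover have "((C, l, X), med.cls C \<phi>) \<in> ex_obj (set_cat U) (medvedev app A' U) X"
    using C X med.cls_in_Fib[OF C(3)] by (simp add: ex_obj_def medvedev_reflection)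
  ultimately show ?thesis
    by blast
qed

end

theorem theorem6p34:
  fixes app :: "'a papp" and A' :: "'a set" and U :: "'u set set"
  assumes "pca app"
    and "elementary_sub_pca app A'"
    and "set_universe U"
    and "small_powerset U TYPE('a)"
  shows "isomorphic_doctrines (set_cat U)
           (full_ex_completion (set_cat U) (medvedev app A' U))
           (doctrine_D app A' U)"
proof -
  interpret sub_pca_universe app A' U
    using assms by unfold_locales
  show ?thesis
    \<comment> \<open>Both doctrines become the poset reflections related by \<open>ex\<close>, so
      finite products of sets and essential surjectivity are what remains.\<close>
    unfolding full_ex_completion_def doctrine_D_def
    using has_finite_products_set_cat[OF universe] comparison_ess_surj[OF assms(4)]
    by (intro ex.isomorphic_reflections) auto
qed

end
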